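(* Let $q\in L^1_{loc}(\mathbb{R}_+)$ be real-valued and let $T>0$. Then the kernels $c^T$ (of the integral part of $C^T$) and $V$ (of $K$) satisfy the integral equation $$V(y,t)+c^T(y,t)+\int_y^T c^T(t,s)V(y,s)\,ds=0,\qquad 0<y<t<T.$$
   Context: $\mathbb{R}_+=[0,\infty)$; $L^1_{loc}(\mathbb{R}_+)$ is the space of functions integrable on $[0,a]$ for every $a>0$. Let $v(\xi,\eta)$, $0\le\xi\le\eta$, be the continuous solution of $$v(\xi,\eta)=-\frac12\int_{\xi/2}^{\eta/2}q(\alpha)\,d\alpha-\frac14\int_0^\xi d\xi_1\int_\xi^\eta d\eta_1\, q\Big(\frac{\eta_1-\xi_1}{2}\Big)v(\xi_1,\eta_1),$$ and $w(x,s)=v(s-x,s+x)$ for $0\le x\le s$; thus $w$ is the (generalized) solution of the Goursat problem $w_{ss}-w_{xx}+q(x)w=0$ for $0<x<s$, $w(0,s)=0$, $w(x,x)=-\frac12\int_0^x q$. The response function is $r(t)=w_x(0,t)$, i.e. $r(t)=-\frac12 q(\frac t2)-\frac12\int_0^t q(\frac{t-\zeta}{2})v(\zeta,t)\,d\zeta$, which lies in $L^1_{loc}(\mathbb{R}_+)$. Put $p(t)=\frac12\int_0^{|t|}r(s)\,ds$ and $c^T(t,s)=p(2T-t-s)-p(t-s)$ for $t,s\in[0,T]$. The control operator $W^T$ on $L^2(0,T)$ is $(W^Tf)(x)=f(T-x)+\int_x^T w(x,\tau)f(T-\tau)\,d\tau$; it is boundedly invertible. The connecting operator $C^T=(W^T)^*W^T$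 has the form $(C^Tf)(t)=f(t)+\int_0^T c^T(t,s)f(s)\,ds$. Let $(J_Ta)(y)=a(T-y)$ on $L^2(0,T)$. The inverse of $W^T$ has the form $(W^T)^{-1}=(I+K)J_T$ with $$(Ka)(t)=\int_0^t V(y,t)a(y)\,dy,\qquad t\in(0,T),$$ i.e. $((W^T)^{-1}a)(t)=a(T-t)+\int_0^tV(y,t)a(T-y)\,dy$, where $V(y,t)$, $0\le y\le t\le T$, is the continuous kernel determined by this formula; it is the (generalized) solution of the Goursat problem $V_{tt}(s,t)-V_{ss}(s,t)+q(T-s)V(s,t)=0$ for $0<s<t<T$, $V(s,T)=0$, $\frac{d}{dt}V(t,t)=-\frac12 q(T-t)$. *)

theory Defs
  imports "HOL-Analysis.Analysis"
begin

definition L1_loc :: "(real \<Rightarrow> real) \<Rightarrow> bool" where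
  "L1_loc q \<longleftrightarrow> (\<forall>a>0. set_integrable lebesgue {0..a} q)"

definition square_integrable :: "real \<Rightarrow> (real \<Rightarrow> real) \<Rightarrow> bool" where
  "square_integrable T f \<longleftrightarrow>
     f \<in> borel_measurable (lebesgue_on {0<..<T}) \<and>
     integrable (lebesgue_on {0<..<T}) (\<lambda>x. (f x)\<^sup>2)"

text \<open>
  The continuous solution of the integral form of the Goursat problem in characteristic
  coordinates. Only the values on \<open>0 \<le> \<xi> \<le> \<eta>\<close> are constrained; there the argument of \<open>q\<close> is
  always nonnegative and all the integrals exist.
\<close>

definition goursat_solution :: "(real \<Rightarrow> real) \<Rightarrow> (real \<Rightarrow> real \<Rightarrow> real) \<Rightarrow> bool" where
  "goursat_solution q v \<longleftrightarrow>
     continuous_on {(\<xi>, \<eta>). 0 \<le> \<xi> \<and> \<xi> \<le> \<eta>} (\<lambda>(\<xi>, \<eta>). v \<xi> \<eta>) \<and>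
     (\<forall>\<xi> \<eta>. 0 \<le> \<xi> \<longrightarrow> \<xi> \<le> \<eta> \<longrightarrow>
        v \<xi> \<eta> = - (1 / 2) * (LINT \<alpha>:{\<xi> / 2..\<eta> / 2}|lebesgue. q \<alpha>)
          - (1 / 4) * (LINT \<xi>1:{0..\<xi>}|lebesgue. LINT \<eta>1:{\<xi>..\<eta>}|lebesgue.
              q ((\<eta>1 - \<xi>1) / 2) * v \<xi>1 \<eta>1))"

definition wave_kernel :: "(real \<Rightarrow> real \<Rightarrow> real) \<Rightarrow> real \<Rightarrow> real \<Rightarrow> real" where
  "wave_kernel v x s = v (s - x) (s + x)"

text \<open>
  The response function is the trace at \<open>x = 0\<close> of the (generalized) derivative in \<open>x\<close> of
  \<^const>\<open>wave_kernel\<close>. For a merely locally integrable \<open>q\<close> it is defined by the formula that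
  differentiating the integral equation for \<open>v\<close> gives.
\<close>

definition response :: "(real \<Rightarrow> real) \<Rightarrow> (real \<Rightarrow> real \<Rightarrow> real) \<Rightarrow> real \<Rightarrow> real" where
  "response q v t =
     - (1 / 2) * q (t / 2)
     - (1 / 2) * (LINT \<zeta>:{0..t}|lebesgue. q ((t - \<zeta>) / 2) * v \<zeta> t)"

definition half_primitive :: "(real \<Rightarrow> real) \<Rightarrow> real \<Rightarrow> real" where
  "half_primitive r t = (1 / 2) * (LINT s:{0..\<bar>t\<bar>}|lebesgue. r s)"

text \<open>
  The kernel \<open>c\<^sup>T\<close> of the integral part of the connecting operator, given by its expression
  through the response function.
\<close>

definition connecting_kernel ::
  "(real \<Rightarrow> real) \<Rightarrow> (real \<Rightarrow> real \<Rightarrow> real) \<Rightarrow> real \<Rightarrow> real \<Rightarrow> real \<Rightarrow> real" where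
  "connecting_kernel q v T t s =
     half_primitive (response q v) (2 * T - t - s) - half_primitive (response q v) (t - s)"

text \<open>
  Operators on \<open>L\<^sup>2(0, T)\<close> act on representatives; equality of elements of \<open>L\<^sup>2(0, T)\<close> is
  equality almost everywhere on \<open>(0, T)\<close>.
\<close>

definition control_op :: "(real \<Rightarrow> real \<Rightarrow> real) \<Rightarrow> real \<Rightarrow> (real \<Rightarrow> real) \<Rightarrow> real \<Rightarrow> real" where
  "control_op v T f x =
     f (T - x) + (LINT \<tau>:{x..T}|lebesgue. wave_kernel v x \<tau> * f (T - \<tau>))"

definition reflect_op :: "real \<Rightarrow> (real \<Rightarrow> real) \<Rightarrow> real \<Rightarrow> real" where
  "reflect_op T a y = a (T - y)"

definition volterra_op :: "(real \<Rightarrow> real \<Rightarrow> real) \<Rightarrow> (real \<Rightarrow> real) \<Rightarrow> real \<Rightarrow> real" where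
  "volterra_op V a t = (LINT y:{0..t}|lebesgue. V y t * a y)"

definition id_plus_volterra_reflect ::
  "(real \<Rightarrow> real \<Rightarrow> real) \<Rightarrow> real \<Rightarrow> (real \<Rightarrow> real) \<Rightarrow> real \<Rightarrow> real" where
  "id_plus_volterra_reflect V T a t = reflect_op T a t + volterra_op V (reflect_op T a) t"

text \<open>
  \<open>V\<close> is the continuous kernel for which \<open>(I + K) J\<^sub>T\<close> is the (two-sided) inverse of the control
  operator on \<open>L\<^sup>2(0, T)\<close>. Its values outside \<open>0 \<le> y \<le> t \<le> T\<close> are irrelevant.
\<close>

definition inverse_control_kernel ::
  "(real \<Rightarrow> real \<Rightarrow> real) \<Rightarrow> real \<Rightarrow> (real \<Rightarrow> real \<Rightarrow> real) \<Rightarrow> bool" where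
  "inverse_control_kernel v T V \<longleftrightarrow>
     continuous_on {(y, t). 0 \<le> y \<and> y \<le> t \<and> t \<le> T} (\<lambda>(y, t). V y t) \<and>
     (\<forall>a. square_integrable T a \<longrightarrow>
        (AE x in lebesgue_on {0<..<T}.
           control_op v T (id_plus_volterra_reflect V T a) x = a x) \<and>
        (AE t in lebesgue_on {0<..<T}.
           id_plus_volterra_reflect V T (control_op v T a) t = a t))"

end

theory Submission imports Defs begin

text \<open>
  Put \<open>w(x, t) = v(t - x, t + x)\<close> and let \<open>W\<close> be the Volterra operator
  \<open>(Wb)(x) = b(x) + \<integral>\<^sub>x\<^sup>T w(x, s) b(s) ds\<close>, which is the control operator up to the reflection
  \<open>t \<mapsto> T - t\<close>. After the same reflection \<open>V\<close> becomes the kernel \<open>H(x, z) = V(T - z, T - x)\<close> of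
  \<open>W\<^sup>-\<^sup>1 - I\<close>. The symmetric kernel of \<open>W\<^sup>* W - I\<close> is, for \<open>s \<le> t\<close>,
  \<open>gram(s, t) = w(s, t) + \<integral>\<^sub>0\<^sup>s w(x, t) w(x, s) dx\<close>, and \<open>W\<^sup>* W W\<^sup>-\<^sup>1 = W\<^sup>*\<close> is lower triangular.
  That the kernel of \<open>(I + gram) (I + H)\<close> vanishes above the diagonal is the equation to be proved,
  provided that \<open>gram\<close> is the reflected connecting kernel, that is, provided that
  \<open>gram(s, t) = 1/2 \<integral>\<close> of the response function over \<open>[t - s, t + s]\<close>.

  This identity is the heart of the matter. Formally \<open>w\<close> solves the wave equation with potential
  \<open>q\<close>, in the product \<open>w(x, t) w(x, s)\<close> the potential cancels from \<open>\<partial>\<^sub>t\<^sup>2 - \<partial>\<^sub>s\<^sup>2\<close>, so \<open>gram\<close> solves the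
  free wave equation in \<open>(s, t)\<close>, with \<open>gram(0, t) = 0\<close> and \<open>\<partial>\<^sub>s gram(0, t)\<close> equal to the response
  function; d'Alembert's formula then gives the claim. For a merely integrable \<open>q\<close> these derivatives
  do not exist, so the argument is carried out with finite differences. For a diamond with centre
  \<open>(x, t)\<close> and half diagonal \<open>h\<close> the Goursat equation says that the alternating sum
  \<open>w(x + h, t) + w(x - h, t) - w(x, t + h) - w(x, t - h)\<close> is the integral of \<open>q w / 2\<close> over the diamond.
  Up to the oscillation of the continuous function \<open>w\<close> this is \<open>w(x, t)\<close> times a weighted mean of
  \<open>q\<close> around \<open>x\<close>. Translating the integration variable by \<open>h\<close> replaces the formal integration by
  parts, and both the potential terms and the contributions of the moving endpoint \<open>x = s\<close> cancel,
  so that the alternating sum of \<open>gram\<close> over a diamond of size \<open>h\<close> is bounded by an arbitrarily small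
  multiple of an additive quantity (\<open>gram_dalembert_bound\<close>, \<open>small_diamonds\<close>). Cutting a diamond into
  ever smaller ones shows that the alternating sum is zero (\<open>diamond_zero\<close>). Near \<open>s = 0\<close> the
  difference between \<open>gram\<close> and d'Alembert's formula is \<open>o(s)\<close> (\<open>gram_bottom\<close>), and cutting a
  triangle standing on the axis \<open>s = 0\<close> into diamonds and small triangles removes this error as well
  (\<open>gram_eq_dalembert_solution\<close>).
\<close>

section \<open>Continuity and bounds for integrals of continuous functions\<close>

lemma continuous_on_section:
  fixes w :: "real \<Rightarrow> real \<Rightarrow> real"
  assumes "continuous_on UNIV (\<lambda>(x, y). w x y)" "continuous_on S a" "continuous_on S b"
  shows "continuous_on S (\<lambda>z. w (a z) (b z))"
proof -
  have "continuous_on S ((\<lambda>(x, y). w x y) \<circ> (\<lambda>z. (a z, b z)))"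
    by (intro continuous_on_compose continuous_on_Pair assms
          continuous_on_subset[OF assms(1)]) auto
  thus ?thesis by (simp add: o_def)
qed

lemma continuous_on_UNIV_compose:
  fixes G :: "real \<Rightarrow> real"
  assumes "continuous_on UNIV G" "continuous_on S a"
  shows "continuous_on S (\<lambda>z. G (a z))"
  by (rule continuous_on_compose2[OF assms]) auto

lemma integral_rescale:
  fixes f :: "real \<Rightarrow> real"
  assumes "a \<le> b" "continuous_on {a..b} f"
  shows "integral {a..b} f = (b - a) * integral {0..1} (\<lambda>u. f (a + (b - a) * u))"
proof (cases "a = b")
  case False
  hence ab: "0 < b - a" using assms by simp
  have "(f has_integral integral {a..b} f) (cbox a b)"
    using integrable_continuous_real[OF assms(2)] by auto
  hence "((\<lambda>u. f (a + (b - a) * u)) has_integral (integral {a..b} f / (b - a))) {0..1}"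
    using has_integral_affinity_iff[OF ab, of f a "integral {a..b} f" a b] ab
    by (simp add: divide_inverse mult.commute add.commute)
  thus ?thesis using ab by (simp add: integral_unique)
qed simp

text \<open>
  Rescaling to a fixed interval turns the moving endpoints into parameters of the integrand.
\<close>

lemma continuous_on_variable_integral:
  fixes f :: "'a::topological_space \<Rightarrow> real \<Rightarrow> real"
  assumes f: "continuous_on (S \<times> UNIV) (\<lambda>(z, y). f z y)"
    and ab: "continuous_on S a" "continuous_on S b"
    and le: "\<And>z. z \<in> S \<Longrightarrow> a z \<le> b z"
  shows "continuous_on S (\<lambda>z. integral {a z..b z} (f z))"
proof -
  have "continuous_on (S \<times> cbox 0 1) ((\<lambda>(z, y). f z y) \<circ> (\<lambda>(z, u). (z, a z + (b z - a z) * u)))"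
    unfolding split_beta
    by (intro continuous_on_compose continuous_intros continuous_on_compose2[OF ab(1)]
          continuous_on_compose2[OF ab(2)] continuous_on_subset[OF f, unfolded split_beta]) auto
  hence "continuous_on S (\<lambda>z. (b z - a z) * integral (cbox 0 1) (\<lambda>u. f z (a z + (b z - a z) * u)))"
    by (intro continuous_intros ab integral_continuous_on_param) (simp add: o_def split_beta)
  thus ?thesis
  proof (rule continuous_on_eq)
    fix z assume "z \<in> S"
    have "continuous_on {a z..b z} ((\<lambda>(z, y). f z y) \<circ> (\<lambda>y. (z, y)))"
      by (intro continuous_on_compose continuous_intros continuous_on_subset[OF f]) (use \<open>z \<in> S\<close> in auto)
    hence "continuous_on {a z..b z} (f z)" by (simp add: o_def)
    from integral_rescale[OF le[OF \<open>z \<in> S\<close>] this]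
    show "(b z - a z) * integral (cbox 0 1) (\<lambda>u. f z (a z + (b z - a z) * u)) = integral {a z..b z} (f z)"
      by simp
  qed
qed

lemma integral_bound:
  fixes f g :: "real \<Rightarrow> real"
  assumes "continuous_on {a..b} f" "continuous_on {a..b} g" "\<And>x. x \<in> {a..b} \<Longrightarrow> \<bar>f x\<bar> \<le> g x"
  shows "\<bar>integral {a..b} f\<bar> \<le> integral {a..b} g"
  using integral_norm_bound_integral[of f "{a..b}" g] assms
  by (auto intro: integrable_continuous_real)

lemma integral_bound_const:
  fixes f :: "real \<Rightarrow> real"
  assumes "continuous_on {a..b} f" "a \<le> b" "\<And>x. x \<in> {a..b} \<Longrightarrow> \<bar>f x\<bar> \<le> c"
  shows "\<bar>integral {a..b} f\<bar> \<le> c * (b - a)"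
proof -
  have "\<bar>integral {a..b} f\<bar> \<le> integral {a..b} (\<lambda>_. c)"
    by (rule integral_bound) (use assms in auto)
  thus ?thesis using assms(2) by (simp add: mult.commute)
qed

section \<open>Tent averages\<close>

text \<open>
  If \<open>G\<close> is a primitive of \<open>q\<close>, then \<open>tent G x h\<close> is the double integral of \<open>q (x + (b - a) / 2)\<close>
  over \<open>a, b \<in> [-h, h]\<close>, that is, \<open>4 \<integral> q y * max 0 (h - \<bar>y - x\<bar>) dy\<close>. Written with \<open>G\<close>, the integrand
  is continuous even if \<open>q\<close> is only integrable.
\<close>

definition tent :: "(real \<Rightarrow> real) \<Rightarrow> real \<Rightarrow> real \<Rightarrow> real" where
  "tent G x h = integral {-h..h} (\<lambda>a. 2 * (G (x + (h - a) / 2) - G (x - (h + a) / 2)))"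

text \<open>
  A square with side \<open>4 h\<close> consists of four squares with side \<open>2 h\<close>, two of which have centres with
  the same difference \<open>x\<close> of coordinates. This additivity makes \<open>tent F\<close>, with \<open>F\<close> a primitive of
  \<open>\<bar>q\<bar>\<close>, a usable error bound for subdivisions.
\<close>

lemma tent_double:
  assumes G: "continuous_on UNIV G" and h: "0 \<le> h"
  shows "tent G x (2 * h) = tent G (x + h) h + tent G (x - h) h + 2 * tent G x h"
proof -
  note [continuous_intros] = continuous_on_UNIV_compose[OF G]
  let ?g = "\<lambda>a. 2 * (G (x + h - a / 2) - G (x - h - a / 2))"
  let ?u = "\<lambda>a. 2 * (G (x + h - a / 2) - G (x - a / 2))"
  let ?l = "\<lambda>a. 2 * (G (x - a / 2) - G (x - h - a / 2))"
  have int: "f integrable_on {a..b}" if "continuous_on UNIV f" for f :: "real \<Rightarrow> real" and a b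
    by (rule integrable_continuous_real, rule continuous_on_subset[OF that]) auto
  have "tent G x (2 * h) = integral {-2 * h..2 * h} ?g"
    by (simp add: tent_def algebra_simps add_divide_distrib diff_divide_distrib)
  also have "\<dots> = integral {-2 * h..0} ?g + integral {0..2 * h} ?g"
    by (rule Henstock_Kurzweil_Integration.integral_combine[symmetric]) (use h in \<open>auto intro!: int continuous_intros\<close>)
  also have "integral {-2 * h..0} ?g = integral {-2 * h..0} ?u + integral {-2 * h..0} ?l"
    by (subst integral_add[symmetric]) (auto intro!: int continuous_intros simp: algebra_simps)
  also have "integral {0..2 * h} ?g = integral {0..2 * h} ?u + integral {0..2 * h} ?l"
    by (subst integral_add[symmetric]) (auto intro!: int continuous_intros simp: algebra_simps)
  also have "integral {-2 * h..0} ?u = tent G (x + h) h"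
    using integral_shift_real_ivl[of "-2 * h" "-h" 0 ?u]
    by (simp add: tent_def algebra_simps add_divide_distrib diff_divide_distrib)
  also have "integral {-2 * h..0} ?l = tent G x h"
    using integral_shift_real_ivl[of "-2 * h" "-h" 0 ?l]
    by (simp add: tent_def algebra_simps add_divide_distrib diff_divide_distrib)
  also have "integral {0..2 * h} ?u = tent G x h"
    using integral_shift_real_ivl[of 0 h "2 * h" ?u]
    by (simp add: tent_def algebra_simps add_divide_distrib diff_divide_distrib)
  also have "integral {0..2 * h} ?l = tent G (x - h) h"
    using integral_shift_real_ivl[of 0 h "2 * h" ?l]
    by (simp add: tent_def algebra_simps add_divide_distrib diff_divide_distrib)
  finally show ?thesis by simp
qed

lemma tent_nonneg:
  assumes "mono F"
  shows "0 \<le> tent F x h"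
  unfolding tent_def
  by (cases "(\<lambda>a. 2 * (F (x + (h - a) / 2) - F (x - (h + a) / 2))) integrable_on {-h..h}")
     (auto intro!: integral_nonneg monoD[OF assms] simp: not_integrable_integral field_simps)

lemma tent_le:
  assumes F: "mono F" "continuous_on UNIV F" and h: "0 \<le> h"
  shows "tent F x h \<le> 4 * h * (F (x + h) - F (x - h))"
proof -
  note [continuous_intros] = continuous_on_UNIV_compose[OF F(2)]
  have "\<bar>tent F x h\<bar> \<le> (2 * (F (x + h) - F (x - h))) * (h - (- h))"
    unfolding tent_def
  proof (rule integral_bound_const)
    fix a assume a: "a \<in> {-h..h}"
    have "F (x + (h - a) / 2) \<le> F (x + h)" "F (x - h) \<le> F (x - (h + a) / 2)"
         "F (x - (h + a) / 2) \<le> F (x + (h - a) / 2)"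
      using a by (auto intro!: monoD[OF F(1)] simp: field_simps)
    thus "\<bar>2 * (F (x + (h - a) / 2) - F (x - (h + a) / 2))\<bar> \<le> 2 * (F (x + h) - F (x - h))"
      by auto
  qed (use h in \<open>auto intro!: continuous_intros\<close>)
  thus ?thesis by (simp add: algebra_simps)
qed

lemma tent_abs_le:
  assumes "continuous_on UNIV G" "continuous_on UNIV F" "0 \<le> h"
    and "\<And>a b. a \<le> b \<Longrightarrow> \<bar>G b - G a\<bar> \<le> F b - F a"
  shows "\<bar>tent G x h\<bar> \<le> tent F x h"
proof -
  note [continuous_intros] = continuous_on_UNIV_compose[OF assms(1)] continuous_on_UNIV_compose[OF assms(2)]
  have "x - (h + a) / 2 \<le> x + (h - a) / 2" for a using assms(3) by (simp add: field_simps)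
  from assms(4)[OF this] have "\<bar>2 * (G (x + (h - a) / 2) - G (x - (h + a) / 2))\<bar>
      \<le> 2 * (F (x + (h - a) / 2) - F (x - (h + a) / 2))" for a
    unfolding abs_mult abs_numeral by (rule mult_left_mono) simp
  thus ?thesis
    unfolding tent_def by (intro integral_bound continuous_intros) auto
qed

section \<open>The Gram kernel and the discrete wave operator\<close>

definition correlation :: "(real \<Rightarrow> real \<Rightarrow> real) \<Rightarrow> real \<Rightarrow> real \<Rightarrow> real" where
  "correlation w s t = integral {0..s} (\<lambda>x. w x t * w x s)"

text \<open>
  The kernel of \<open>W\<^sup>* W - I\<close> at \<open>s \<le> t\<close>, where \<open>W - I\<close> has the kernel \<open>w\<close>.
\<close>

definition gram :: "(real \<Rightarrow> real \<Rightarrow> real) \<Rightarrow> real \<Rightarrow> real \<Rightarrow> real" where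
  "gram w s t = w s t + correlation w s t"

lemma gram_continuous:
  assumes w: "continuous_on UNIV (\<lambda>(x, y). w x y)"
    and ab: "continuous_on S a" "continuous_on S b" "\<And>z. z \<in> S \<Longrightarrow> 0 \<le> a z"
  shows "continuous_on S (\<lambda>z. gram w (a z) (b z))"
  unfolding gram_def correlation_def
  by (intro continuous_on_variable_integral continuous_on_section[OF w] continuous_intros ab)
     (auto simp: split_beta intro!: continuous_intros continuous_on_section[OF w]
        continuous_on_compose2[OF ab(1)] continuous_on_compose2[OF ab(2)])

text \<open>
  The alternating sum over the vertices of a diamond. It vanishes for the solutions
  \<open>P (t + s) - P (t - s)\<close> of the free wave equation.
\<close>

definition dalembert :: "(real \<Rightarrow> real \<Rightarrow> real) \<Rightarrow> real \<Rightarrow> real \<Rightarrow> real \<Rightarrow> real" where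
  "dalembert w x t h = w (x + h) t + w (x - h) t - w x (t + h) - w x (t - h)"

text \<open>
  What the finite difference argument uses about a solution \<open>w\<close> of the wave equation with potential
  \<open>q\<close>. Here \<open>G\<close> and \<open>F\<close> stand for primitives of \<open>q\<close> and \<open>\<bar>q\<bar>\<close>; the function \<open>w\<close>, whose natural domain is
  \<open>0 \<le> x \<le> t\<close>, is extended to an odd function of \<open>x\<close>. The assumption \<open>interior\<close> is the integrated wave
  equation on a diamond inside the domain, with \<open>w\<close> frozen at the centre; \<open>boundary\<close> is a crude bound for
  diamonds which reach beyond \<open>x = 0\<close>; and \<open>front\<close> says how \<open>w\<close> varies along the characteristic next
  to the front \<open>x = t\<close>, where \<open>w (x, x) = - G x / 2\<close> up to a constant.
\<close>

locale wave_scheme =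
  fixes w :: "real \<Rightarrow> real \<Rightarrow> real" and G F :: "real \<Rightarrow> real" and R C N :: real
  assumes w_cont: "continuous_on UNIV (\<lambda>(x, t). w x t)"
    and w_le: "\<And>x t. \<bar>w x t\<bar> \<le> C"
    and w_odd: "\<And>x t. \<bar>x\<bar> \<le> t \<Longrightarrow> t + \<bar>x\<bar> \<le> R \<Longrightarrow> w (- x) t = - w x t"
    and G_cont: "continuous_on UNIV G" and F_cont: "continuous_on UNIV F"
    and F_mono: "mono F" and F_nonneg: "\<And>x. 0 \<le> F x" and F_le: "\<And>x. F x \<le> N"
    and G_le_F: "\<And>a b. a \<le> b \<Longrightarrow> \<bar>G b - G a\<bar> \<le> F b - F a"
    and interior: "\<And>x t h \<omega>. 0 \<le> h \<Longrightarrow> h \<le> x \<Longrightarrow> x + h \<le> t \<Longrightarrow> x + t + h \<le> R \<Longrightarrow>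
        (\<And>y \<tau>. \<bar>y - x\<bar> \<le> h \<Longrightarrow> \<bar>\<tau> - t\<bar> \<le> h \<Longrightarrow> 0 \<le> y \<Longrightarrow> y \<le> \<tau> \<Longrightarrow> y + \<tau> \<le> R \<Longrightarrow> \<bar>w y \<tau> - w x t\<bar> \<le> \<omega>) \<Longrightarrow>
        \<bar>dalembert w x t h - 1 / 4 * w x t * tent G x h\<bar> \<le> 1 / 4 * \<omega> * tent F x h"
    and boundary: "\<And>x t h. 0 \<le> x \<Longrightarrow> x \<le> h \<Longrightarrow> x + h \<le> t \<Longrightarrow> x + t + h \<le> R \<Longrightarrow>
        \<bar>dalembert w x t h\<bar> \<le> 2 * C * N * h"
    and front: "\<And>s a h. \<bar>a\<bar> \<le> h \<Longrightarrow> 2 * h \<le> s \<Longrightarrow> 2 * s - a + h \<le> R \<Longrightarrow>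
        \<bar>w (s - a - h) s - w (s - a) (s + h) - 1 / 2 * (G (s + (h - a) / 2) - G (s - (h + a) / 2))\<bar>
          \<le> C * h * (F (s + h) - F (s - 2 * h))"
begin

lemmas [continuous_intros] = continuous_on_section[OF w_cont]
  continuous_on_UNIV_compose[OF G_cont] continuous_on_UNIV_compose[OF F_cont]
  gram_continuous[OF w_cont]

lemma dalembert_continuous [continuous_intros]:
  assumes "continuous_on S a" "continuous_on S b" "continuous_on S h"
  shows "continuous_on S (\<lambda>z. dalembert w (a z) (b z) (h z))"
  unfolding dalembert_def by (intro continuous_intros assms)

lemma C_nonneg: "0 \<le> C"
  using w_le[of 0 0] by linarith

lemma N_nonneg: "0 \<le> N"
  using F_nonneg[of 0] F_le[of 0] by linarith

lemma w_zero: "0 \<le> t \<Longrightarrow> t \<le> R \<Longrightarrow> w 0 t = 0"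
  using w_odd[of 0 t] by simp

text \<open>
  The discrete integration by parts: \<open>x\<close> is translated by \<open>h\<close> and \<open>-h\<close>, so that shifts of \<open>w\<close> in
  \<open>t\<close> become shifts in \<open>s\<close>. In the first integral the potential cancels; the second and the third
  come from the endpoint \<open>x = s\<close>. There is no contribution from \<open>x = 0\<close>, because \<open>w\<close> is odd in \<open>x\<close>.
\<close>

lemma correlation_difference:
  assumes h: "0 \<le> h" "h \<le> s" "s + h \<le> t" "s + t + h \<le> R"
  shows "correlation w s (t + h) + correlation w s (t - h) - correlation w (s + h) t - correlation w (s - h) t =
    integral {0..s - h} (\<lambda>x. w x t * dalembert w x s h - dalembert w x t h * w x s)
    - integral {s - h..s} (\<lambda>x. dalembert w x t h * w x s)
    + integral {s - h..s + h} (\<lambda>x. w x t * (w (x - h) s - w x (s + h)))"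
proof -
  let ?m = "\<lambda>x. w x t * w (x - h) s" and ?p = "\<lambda>x. w x t * w (x + h) s"
  have m1: "integral {0..s} (\<lambda>x. w (x + h) t * w x s) = integral {h..s + h} ?m"
    using integral_shift_real_ivl[of h h "s + h" ?m] by simp
  have "integral {0..s} (\<lambda>x. w (x - h) t * w x s) = integral {-h..s - h} ?p"
    using integral_shift_real_ivl[of "-h" "-h" "s - h" ?p] by simp
  also have "\<dots> = integral {-h..0} ?p + integral {0..s - h} ?p"
    by (rule Henstock_Kurzweil_Integration.integral_combine[symmetric]) (use h in \<open>auto intro!: integrable_continuous_real continuous_intros\<close>)
  also have "integral {-h..0} ?p = integral {0..h} (\<lambda>x. ?p (- x))"
    using Henstock_Kurzweil_Integration.integral_reflect_real[of h 0 "\<lambda>x. ?p (- x)"] by simp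
  also have "\<dots> = integral {0..h} ?m"
  proof (rule integral_cong)
    fix x assume x: "x \<in> {0..h}"
    have "w (- x) t = - w x t" by (rule w_odd) (use x h in auto)
    moreover have "w (- (x - h)) s = - w (x - h) s" by (rule w_odd) (use x h in auto)
    ultimately show "?p (- x) = ?m x" by simp
  qed
  finally have m2: "integral {0..s} (\<lambda>x. w (x - h) t * w x s) = integral {0..h} ?m + integral {0..s - h} ?p" .
  have m3: "integral {0..h} ?m + integral {h..s + h} ?m = integral {0..s - h} ?m + integral {s - h..s + h} ?m"
    using Henstock_Kurzweil_Integration.integral_combine[of 0 h "s + h" ?m] Henstock_Kurzweil_Integration.integral_combine[of 0 "s - h" "s + h" ?m] h
    by (simp add: integrable_continuous_real continuous_intros)
  have e1: "correlation w s (t + h) + correlation w s (t - h) = integral {0..s} (\<lambda>x. w (x + h) t * w x s)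
      + integral {0..s} (\<lambda>x. w (x - h) t * w x s) - integral {0..s} (\<lambda>x. dalembert w x t h * w x s)"
    unfolding correlation_def
    by (subst integral_add[symmetric] integral_diff[symmetric];
        (intro integrable_continuous_real continuous_intros integrable_add integrable_diff)?)+
       (simp add: dalembert_def algebra_simps)
  have e2: "integral {0..s} (\<lambda>x. dalembert w x t h * w x s) =
      integral {0..s - h} (\<lambda>x. dalembert w x t h * w x s) + integral {s - h..s} (\<lambda>x. dalembert w x t h * w x s)"
    by (rule Henstock_Kurzweil_Integration.integral_combine[symmetric]) (use h in \<open>auto intro!: integrable_continuous_real continuous_intros\<close>)
  have e3: "correlation w (s + h) t = integral {0..s - h} (\<lambda>x. w x t * w x (s + h))
      + integral {s - h..s + h} (\<lambda>x. w x t * w x (s + h))"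
    unfolding correlation_def
    by (rule Henstock_Kurzweil_Integration.integral_combine[symmetric]) (use h in \<open>auto intro!: integrable_continuous_real continuous_intros\<close>)
  have e4: "integral {s - h..s + h} (\<lambda>x. w x t * (w (x - h) s - w x (s + h)))
     = integral {s - h..s + h} ?m - integral {s - h..s + h} (\<lambda>x. w x t * w x (s + h))"
    by (subst integral_diff[symmetric]) (auto intro!: integrable_continuous_real continuous_intros simp: algebra_simps)
  have e5: "integral {0..s - h} (\<lambda>x. w x t * dalembert w x s h - dalembert w x t h * w x s)
     = integral {0..s - h} ?p + integral {0..s - h} ?m - integral {0..s - h} (\<lambda>x. w x t * w x (s + h))
       - correlation w (s - h) t - integral {0..s - h} (\<lambda>x. dalembert w x t h * w x s)"
    unfolding correlation_def
    by (subst integral_add[symmetric] integral_diff[symmetric];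
        (intro integrable_continuous_real continuous_intros integrable_add integrable_diff)?)+
       (simp add: dalembert_def algebra_simps)
  show ?thesis using e1 e2 e3 e4 e5 m1 m2 m3 by linarith
qed

text \<open>
  The integral telescopes. This gives the total of the error terms \<open>h * (F (x + h) - F (x - h))\<close> the
  order \<open>h\<^sup>2\<close>, although each of them is only \<open>o(h)\<close>.
\<close>

lemma window_integral_le:
  assumes h: "0 \<le> h" "2 * h \<le> s"
  shows "integral {h..s - h} (\<lambda>x. F (x + h) - F (x - h)) \<le> 2 * h * N"
proof -
  have 1: "integral {h..s - h} (\<lambda>x. F (x + h)) = integral {2 * h..s} F"
    using integral_shift_real_ivl[of "2 * h" h s F] by simp
  have 2: "integral {h..s - h} (\<lambda>x. F (x - h)) = integral {0..s - 2 * h} F"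
    using integral_shift_real_ivl[of 0 "-h" "s - 2 * h" F] by simp
  have Fi: "F integrable_on {a..b}" for a b
    using F_cont by (intro integrable_continuous_real) (auto intro: continuous_on_subset)
  have 3: "integral {0..2 * h} F + integral {2 * h..s} F = integral {0..s - 2 * h} F + integral {s - 2 * h..s} F"
    using Henstock_Kurzweil_Integration.integral_combine[OF _ _ Fi, of 0 "2 * h" s]
      Henstock_Kurzweil_Integration.integral_combine[OF _ _ Fi, of 0 "s - 2 * h" s] h by simp
  have 4: "0 \<le> integral {0..2 * h} F"
    by (rule integral_nonneg[OF Fi]) (use F_nonneg in auto)
  have 5: "integral {s - 2 * h..s} F \<le> integral {s - 2 * h..s} (\<lambda>_. N)"
    by (rule integral_le[OF Fi]) (use F_le in auto)
  show ?thesis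
    using 1 2 3 4 5 h
    by (subst integral_diff) (auto intro!: integrable_continuous_real continuous_intros)
qed

text \<open>
  Here \<open>\<omega>\<close> and \<open>\<kappa>\<close> bound the oscillations of \<open>w\<close> and of \<open>F\<close>, which tend to zero with \<open>h\<close>. The leading
  terms, \<open>w s t * tent G s h / 4\<close> from \<open>w\<close> itself and the same quantity from the front part of the
  correlation integral, cancel.
\<close>

lemma gram_dalembert_bound:
  assumes h: "0 \<le> h" "2 * h \<le> s" "s + h \<le> t" "s + t + h \<le> R"
    and osc: "\<And>x t y \<tau>. 0 \<le> x \<Longrightarrow> x \<le> t \<Longrightarrow> x + t \<le> R \<Longrightarrow> 0 \<le> y \<Longrightarrow> y \<le> \<tau> \<Longrightarrow> y + \<tau> \<le> R \<Longrightarrow>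
        \<bar>y - x\<bar> \<le> h \<Longrightarrow> \<bar>\<tau> - t\<bar> \<le> h \<Longrightarrow> \<bar>w y \<tau> - w x t\<bar> \<le> \<omega>"
    and \<kappa>: "F (s + h) - F (s - 2 * h) \<le> \<kappa>"
  shows "\<bar>dalembert (gram w) s t h\<bar> \<le> 1 / 2 * \<omega> * tent F s h + (8 * C * N * \<omega> + 5 * C\<^sup>2 * \<kappa>) * h\<^sup>2"
proof -
  have \<omega>0: "0 \<le> \<omega>" using osc[of 0 t 0 t] h by auto
  have sq: "\<bar>dalembert w x \<tau> h - 1 / 4 * w x \<tau> * tent G x h\<bar> \<le> 1 / 4 * \<omega> * tent F x h"
    if "h \<le> x" "x + h \<le> \<tau>" "x + \<tau> + h \<le> R" for x \<tau>
    by (rule interior) (use h that osc in auto)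
  have small: "\<bar>w x \<tau>\<bar> \<le> \<omega>" if "0 \<le> x" "x \<le> h" "x \<le> \<tau>" "x + \<tau> \<le> R" for x \<tau>
    using osc[of 0 \<tau> x \<tau>] w_zero[of \<tau>] that h by auto

  \<comment> \<open>For \<open>x \<le> h\<close> the diamonds may leave the domain, but \<open>w\<close> is small there because \<open>w 0 t = 0\<close>.\<close>
  have P1a: "\<bar>integral {0..h} (\<lambda>x. w x t * dalembert w x s h - dalembert w x t h * w x s)\<bar>
      \<le> (4 * C * N * h * \<omega>) * (h - 0)"
  proof (rule integral_bound_const)
    fix x assume x: "x \<in> {0..h}"
    have "\<bar>w x t\<bar> * \<bar>dalembert w x s h\<bar> \<le> \<omega> * (2 * C * N * h)"
      by (intro mult_mono small boundary) (use x h \<omega>0 in auto)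
    moreover have "\<bar>w x s\<bar> * \<bar>dalembert w x t h\<bar> \<le> \<omega> * (2 * C * N * h)"
      by (intro mult_mono small boundary) (use x h \<omega>0 in auto)
    ultimately show "\<bar>w x t * dalembert w x s h - dalembert w x t h * w x s\<bar> \<le> 4 * C * N * h * \<omega>"
      unfolding abs_mult[symmetric] by (simp add: mult.commute abs_le_iff)
  qed (use h in \<open>auto intro!: continuous_intros\<close>)

  \<comment> \<open>Freezing \<open>w\<close> at both centres produces the same term \<open>w x t * w x s * tent G x h / 4\<close> twice, with
    opposite signs.\<close>
  have "\<bar>integral {h..s - h} (\<lambda>x. w x t * dalembert w x s h - dalembert w x t h * w x s)\<bar>
      \<le> integral {h..s - h} (\<lambda>x. 2 * C * \<omega> * h * (F (x + h) - F (x - h)))"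
  proof (rule integral_bound)
    fix x assume x: "x \<in> {h..s - h}"
    let ?T = "tent G x h"
    let ?A = "w x t * (dalembert w x s h - 1 / 4 * w x s * ?T)"
    let ?B = "w x s * (dalembert w x t h - 1 / 4 * w x t * ?T)"
    have "w x t * dalembert w x s h - dalembert w x t h * w x s = ?A - ?B"
      by (simp add: algebra_simps)
    hence "\<bar>w x t * dalembert w x s h - dalembert w x t h * w x s\<bar> \<le> \<bar>?A\<bar> + \<bar>?B\<bar>"
      by (simp only: abs_triangle_ineq4)
    also have "\<dots> \<le> C * (1 / 4 * \<omega> * tent F x h) + C * (1 / 4 * \<omega> * tent F x h)"
      unfolding abs_mult[of "w x t"] abs_mult[of "w x s"]
      by (intro add_mono mult_mono w_le sq) (use x h C_nonneg in auto)
    also have "\<dots> = 1 / 2 * C * \<omega> * tent F x h" by simp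
    also have "\<dots> \<le> 1 / 2 * C * \<omega> * (4 * h * (F (x + h) - F (x - h)))"
      by (intro mult_left_mono tent_le[OF F_mono F_cont h(1)]) (use C_nonneg \<omega>0 in auto)
    finally show "\<bar>w x t * dalembert w x s h - dalembert w x t h * w x s\<bar>
       \<le> 2 * C * \<omega> * h * (F (x + h) - F (x - h))" by (simp add: algebra_simps)
  qed (auto intro!: continuous_intros)
  also have "\<dots> = 2 * C * \<omega> * h * integral {h..s - h} (\<lambda>x. F (x + h) - F (x - h))" by simp
  also have "\<dots> \<le> 2 * C * \<omega> * h * (2 * h * N)"
    by (intro mult_left_mono window_integral_le) (use h C_nonneg \<omega>0 in auto)
  finally have P1b: "\<bar>integral {h..s - h} (\<lambda>x. w x t * dalembert w x s h - dalembert w x t h * w x s)\<bar>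
      \<le> 4 * C * N * \<omega> * h\<^sup>2" by (simp add: power2_eq_square mult_ac)
  have "integral {0..s - h} (\<lambda>x. w x t * dalembert w x s h - dalembert w x t h * w x s) =
     integral {0..h} (\<lambda>x. w x t * dalembert w x s h - dalembert w x t h * w x s)
     + integral {h..s - h} (\<lambda>x. w x t * dalembert w x s h - dalembert w x t h * w x s)"
    by (rule Henstock_Kurzweil_Integration.integral_combine[symmetric])
       (use h in \<open>auto intro!: integrable_continuous_real continuous_intros\<close>)
  with P1a P1b have P1: "\<bar>integral {0..s - h} (\<lambda>x. w x t * dalembert w x s h - dalembert w x t h * w x s)\<bar>
      \<le> 8 * C * N * \<omega> * h\<^sup>2" by (simp add: power2_eq_square mult_ac)

  \<comment> \<open>Here the trivial bound is enough: the interval has length \<open>h\<close> and the discrete wave operator is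
    of order \<open>h * \<kappa>\<close>.\<close>
  have "\<bar>integral {s - h..s} (\<lambda>x. dalembert w x t h * w x s)\<bar> \<le> ((3 * C * h * \<kappa>) * C) * (s - (s - h))"
  proof (rule integral_bound_const)
    fix x assume x: "x \<in> {s - h..s}"
    have "\<bar>dalembert w x t h - 1 / 4 * w x t * tent G x h\<bar> \<le> 1 / 4 * (2 * C) * tent F x h"
    proof (rule interior)
      fix y \<tau> show "\<bar>w y \<tau> - w x t\<bar> \<le> 2 * C" using w_le[of y \<tau>] w_le[of x t] by linarith
    qed (use h x in auto)
    moreover have "\<bar>w x t\<bar> * \<bar>tent G x h\<bar> \<le> C * tent F x h"
      by (intro mult_mono w_le tent_abs_le) (use G_cont F_cont h G_le_F C_nonneg in auto)
    moreover have "1 / 4 * (2 * C) * tent F x h = 1 / 2 * (C * tent F x h)"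
      "1 / 4 * w x t * tent G x h = 1 / 4 * (w x t * tent G x h)"
      "3 / 4 * C * tent F x h = 3 / 4 * (C * tent F x h)" by simp_all
    ultimately have "\<bar>dalembert w x t h\<bar> \<le> 3 / 4 * C * tent F x h"
      unfolding abs_mult[symmetric] by linarith
    also have "\<dots> \<le> 3 / 4 * C * (4 * h * (F (x + h) - F (x - h)))"
      by (intro mult_left_mono tent_le[OF F_mono F_cont h(1)]) (use C_nonneg in auto)
    also have "\<dots> \<le> 3 / 4 * C * (4 * h * \<kappa>)"
    proof (intro mult_left_mono)
      have "F (x + h) \<le> F (s + h)" "F (s - 2 * h) \<le> F (x - h)"
        using x by (auto intro!: monoD[OF F_mono])
      thus "F (x + h) - F (x - h) \<le> \<kappa>" using \<kappa> by linarith
    qed (use h C_nonneg in auto)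
    finally have dq: "\<bar>dalembert w x t h\<bar> \<le> 3 * C * h * \<kappa>" by (simp add: mult_ac)
    show "\<bar>dalembert w x t h * w x s\<bar> \<le> 3 * C * h * \<kappa> * C"
      unfolding abs_mult by (intro mult_mono w_le dq order_trans[OF abs_ge_zero dq]) auto
  qed (use h in \<open>auto intro!: continuous_intros\<close>)
  hence P2: "\<bar>integral {s - h..s} (\<lambda>x. dalembert w x t h * w x s)\<bar> \<le> 3 * C\<^sup>2 * \<kappa> * h\<^sup>2"
    by (simp add: power2_eq_square mult_ac)

  let ?f = "\<lambda>x. w x t * (w (x - h) s - w x (s + h))"
  let ?G = "\<lambda>a. 1 / 2 * (G (s + (h - a) / 2) - G (s - (h + a) / 2))"
  let ?F = "\<lambda>a. 1 / 2 * (F (s + (h - a) / 2) - F (s - (h + a) / 2))"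
  \<comment> \<open>The front: substituting \<open>x = s - a\<close> and freezing \<open>w x t\<close> at \<open>x = s\<close> leaves a tent average of \<open>q\<close>.\<close>
  have "integral {s - h..s + h} ?f = integral {-h..h} (\<lambda>a. ?f (s + a))"
    using integral_shift_real_ivl[of "s - h" s "s + h" ?f] by (simp add: add.commute)
  also have "\<dots> = integral {-h..h} (\<lambda>a. ?f (s - a))"
    using Henstock_Kurzweil_Integration.integral_reflect_real[of h "-h" "\<lambda>a. ?f (s - a)"] by simp
  finally have front_eq: "integral {s - h..s + h} ?f = integral {-h..h} (\<lambda>a. ?f (s - a))" .
  have tG: "1 / 4 * w s t * tent G s h = integral {-h..h} (\<lambda>a. w s t * ?G a)"
    unfolding tent_def integral_mult_right[symmetric] by (rule integral_cong) simp
  have "1 / 4 * \<omega> * tent F s h = integral {-h..h} (\<lambda>a. \<omega> * ?F a)"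
    unfolding tent_def integral_mult_right[symmetric] by (rule integral_cong) simp
  moreover have "integral {-h..h} (\<lambda>a. C * (C * h * \<kappa>)) = 2 * C\<^sup>2 * \<kappa> * h\<^sup>2"
    using h(1) by (simp add: power2_eq_square algebra_simps)
  ultimately have tF: "integral {-h..h} (\<lambda>a. \<omega> * ?F a + C * (C * h * \<kappa>)) =
      1 / 4 * \<omega> * tent F s h + 2 * C\<^sup>2 * \<kappa> * h\<^sup>2"
    by (subst integral_add) (auto intro!: integrable_continuous_real continuous_intros)
  have "\<bar>integral {-h..h} (\<lambda>a. ?f (s - a) - w s t * ?G a)\<bar>
     \<le> integral {-h..h} (\<lambda>a. \<omega> * ?F a + C * (C * h * \<kappa>))"
  proof (rule integral_bound)
    fix a assume a: "a \<in> {-h..h}"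
    have alg: "p * d - u * g = p * (d - g) + (p - u) * g" for p d u g :: real
      by (simp add: algebra_simps)
    let ?d = "w (s - a - h) s - w (s - a) (s + h)"
    have "\<bar>?d - ?G a\<bar> \<le> C * h * (F (s + h) - F (s - 2 * h))"
      by (rule front) (use a h in auto)
    also have "\<dots> \<le> C * h * \<kappa>"
      by (intro mult_left_mono \<kappa>) (use h C_nonneg in auto)
    finally have "\<bar>w (s - a) t\<bar> * \<bar>?d - ?G a\<bar> \<le> C * (C * h * \<kappa>)"
      by (intro mult_mono w_le) (use C_nonneg in auto)
    moreover have "\<bar>w (s - a) t - w s t\<bar> * \<bar>?G a\<bar> \<le> \<omega> * ?F a"
    proof (intro mult_mono)
      show "\<bar>w (s - a) t - w s t\<bar> \<le> \<omega>" by (rule osc) (use a h in auto)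
      have "s - (h + a) / 2 \<le> s + (h - a) / 2" using h by (simp add: field_simps)
      from G_le_F[OF this] show "\<bar>?G a\<bar> \<le> ?F a" by simp
    qed (use \<omega>0 in auto)
    moreover have "?f (s - a) - w s t * ?G a = w (s - a) t * (?d - ?G a) + (w (s - a) t - w s t) * ?G a"
      by (rule alg)
    ultimately show "\<bar>?f (s - a) - w s t * ?G a\<bar> \<le> \<omega> * ?F a + C * (C * h * \<kappa>)"
      unfolding abs_mult[symmetric] by linarith
  qed (auto intro!: continuous_intros)
  moreover have "integral {-h..h} (\<lambda>a. ?f (s - a) - w s t * ?G a)
     = integral {s - h..s + h} ?f - 1 / 4 * w s t * tent G s h"
    unfolding front_eq tG
    by (rule integral_diff) (auto intro!: integrable_continuous_real continuous_intros)
  ultimately have P3: "\<bar>integral {s - h..s + h} ?f - 1 / 4 * w s t * tent G s h\<bar>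
     \<le> 1 / 4 * \<omega> * tent F s h + 2 * C\<^sup>2 * \<kappa> * h\<^sup>2"
    using tF by simp

  have P4: "\<bar>dalembert w s t h - 1 / 4 * w s t * tent G s h\<bar> \<le> 1 / 4 * \<omega> * tent F s h"
    by (rule sq) (use h in auto)
  have "dalembert (gram w) s t h = dalembert w s t h -
      (correlation w s (t + h) + correlation w s (t - h) - correlation w (s + h) t - correlation w (s - h) t)"
    by (simp add: dalembert_def gram_def)
  also have "correlation w s (t + h) + correlation w s (t - h) - correlation w (s + h) t - correlation w (s - h) t =
    integral {0..s - h} (\<lambda>x. w x t * dalembert w x s h - dalembert w x t h * w x s)
    - integral {s - h..s} (\<lambda>x. dalembert w x t h * w x s) + integral {s - h..s + h} ?f"
    by (rule correlation_difference) (use h in auto)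
  finally have eq: "dalembert (gram w) s t h = dalembert w s t h -
    (integral {0..s - h} (\<lambda>x. w x t * dalembert w x s h - dalembert w x t h * w x s)
    - integral {s - h..s} (\<lambda>x. dalembert w x t h * w x s) + integral {s - h..s + h} ?f)" .
  have tri: "\<bar>d - (i - j + k)\<bar> \<le> (p + q) + (e1 + e2)"
    if "\<bar>i\<bar> \<le> e1" "\<bar>j\<bar> \<le> e2" "\<bar>k - m\<bar> \<le> p" "\<bar>d - m\<bar> \<le> q" for d i j k m p q e1 e2 :: real
    using that by linarith
  show ?thesis
    unfolding eq by (rule order_trans[OF tri[OF P1 P2 P3 P4]]) (simp add: algebra_simps)
qed

lemma small_diamonds:
  assumes "0 < \<epsilon>"
  shows "\<exists>\<delta>>0. \<forall>h s t. 0 \<le> h \<longrightarrow> h \<le> \<delta> \<longrightarrow> 2 * h \<le> s \<longrightarrow> s + h \<le> t \<longrightarrow> s + t + h \<le> R \<longrightarrow>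
     \<bar>dalembert (gram w) s t h\<bar> \<le> \<epsilon> * (tent F s h + h\<^sup>2)"
proof -
  \<comment> \<open>The values of \<open>\<omega>\<close> and \<open>\<kappa>\<close> make every coefficient in the preceding bound at most \<open>\<epsilon>\<close>.\<close>
  define \<omega> where "\<omega> = \<epsilon> / (2 * (8 * C * N + 1))"
  define \<kappa> where "\<kappa> = \<epsilon> / (2 * (5 * C\<^sup>2 + 1))"
  have pos: "0 < 8 * C * N + 1" "0 < 5 * C\<^sup>2 + 1"
    using mult_nonneg_nonneg[OF C_nonneg N_nonneg] by (auto simp: add_nonneg_pos)
  have \<omega>: "0 < \<omega>" "8 * C * N * \<omega> \<le> \<epsilon> / 2" "\<omega> \<le> \<epsilon> / 2"
    using pos assms mult_nonneg_nonneg[OF mult_nonneg_nonneg[OF C_nonneg N_nonneg] less_imp_le[OF assms]]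
    by (auto simp: \<omega>_def field_simps)
  have \<kappa>: "0 < \<kappa>" "5 * C\<^sup>2 * \<kappa> \<le> \<epsilon> / 2"
    using pos assms by (auto simp: \<kappa>_def field_simps)
  have "uniformly_continuous_on ({0..R} \<times> {0..R}) (\<lambda>(x, t). w x t)"
    by (intro compact_uniformly_continuous continuous_on_subset[OF w_cont] compact_Times) auto
  from uniformly_continuous_onE[OF this \<omega>(1)] obtain d1 where d1: "0 < d1"
    "\<And>x t y \<tau>. x \<in> {0..R} \<Longrightarrow> t \<in> {0..R} \<Longrightarrow> y \<in> {0..R} \<Longrightarrow> \<tau> \<in> {0..R} \<Longrightarrow>
       dist (y, \<tau>) (x, t) < d1 \<Longrightarrow> dist (w y \<tau>) (w x t) < \<omega>"
    by (metis (no_types, lifting) SigmaI case_prod_conv)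
  have "uniformly_continuous_on {0..R} F"
    by (intro compact_uniformly_continuous continuous_on_subset[OF F_cont]) auto
  from uniformly_continuous_onE[OF this \<kappa>(1)] obtain d2 where d2: "0 < d2"
    "\<And>x y. x \<in> {0..R} \<Longrightarrow> y \<in> {0..R} \<Longrightarrow> dist y x < d2 \<Longrightarrow> dist (F y) (F x) < \<kappa>"
    by metis
  \<comment> \<open>The increment of \<open>F\<close> in question is over an interval of length \<open>3 * h\<close>; the points at which \<open>w\<close> is compared
    are at most \<open>2 * h\<close> apart.\<close>
  show ?thesis
  proof (intro exI[of _ "min (d1 / 3) (d2 / 4)"] conjI allI impI)
    fix h s t assume h: "0 \<le> h" "h \<le> min (d1 / 3) (d2 / 4)" "2 * h \<le> s" "s + h \<le> t" "s + t + h \<le> R"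
    have "\<bar>dalembert (gram w) s t h\<bar> \<le> 1 / 2 * \<omega> * tent F s h + (8 * C * N * \<omega> + 5 * C\<^sup>2 * \<kappa>) * h\<^sup>2"
    proof (rule gram_dalembert_bound)
      fix x t y \<tau> assume *: "0 \<le> x" "x \<le> t" "x + t \<le> R" "0 \<le> y" "y \<le> \<tau>" "y + \<tau> \<le> R"
        "\<bar>y - x\<bar> \<le> h" "\<bar>\<tau> - t\<bar> \<le> h"
      have "dist (y, \<tau>) (x, t) \<le> \<bar>y - x\<bar> + \<bar>\<tau> - t\<bar>"
        using sqrt_sum_squares_le_sum_abs[of "y - x" "\<tau> - t"] by (simp add: dist_prod_def dist_real_def)
      hence "dist (w y \<tau>) (w x t) < \<omega>"
        by (intro d1) (use * h d1(1) in auto)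
      thus "\<bar>w y \<tau> - w x t\<bar> \<le> \<omega>" by (simp add: dist_real_def)
    next
      have "dist (F (s + h)) (F (s - 2 * h)) < \<kappa>"
        by (intro d2) (use h d2(1) in \<open>auto simp: dist_real_def\<close>)
      thus "F (s + h) - F (s - 2 * h) \<le> \<kappa>" by (simp add: dist_real_def)
    qed (use h in auto)
    also have "\<dots> \<le> \<epsilon> * tent F s h + \<epsilon> * h\<^sup>2"
    proof (intro add_mono mult_right_mono)
      show "1 / 2 * \<omega> \<le> \<epsilon>" using \<omega> assms by simp
      show "0 \<le> tent F s h" by (rule tent_nonneg[OF F_mono])
      show "8 * C * N * \<omega> + 5 * C\<^sup>2 * \<kappa> \<le> \<epsilon>" using \<omega> \<kappa> by simp
    qed auto
    finally show "\<bar>dalembert (gram w) s t h\<bar> \<le> \<epsilon> * (tent F s h + h\<^sup>2)" by (simp add: algebra_simps)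
  qed (use d1 d2 in auto)
qed

text \<open>
  A large diamond is the union of four diamonds of half the size, and both sides of the estimate are
  additive.
\<close>

lemma diamond_doubling:
  assumes small: "\<And>s t. \<sigma> \<le> s - h \<Longrightarrow> s + h \<le> t \<Longrightarrow> s + t + h \<le> R \<Longrightarrow>
      \<bar>dalembert (gram w) s t h\<bar> \<le> \<epsilon> * (tent F s h + h\<^sup>2)"
    and h: "0 \<le> h" and st: "\<sigma> \<le> s - 2 * h" "s + 2 * h \<le> t" "s + t + 2 * h \<le> R"
  shows "\<bar>dalembert (gram w) s t (2 * h)\<bar> \<le> \<epsilon> * (tent F s (2 * h) + (2 * h)\<^sup>2)"
proof -
  have "dalembert (gram w) s t (2 * h) = dalembert (gram w) s (t + h) h + dalembert (gram w) s (t - h) h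
      + dalembert (gram w) (s + h) t h + dalembert (gram w) (s - h) t h"
    by (simp add: dalembert_def algebra_simps)
  moreover have "\<bar>dalembert (gram w) s (t + h) h\<bar> \<le> \<epsilon> * (tent F s h + h\<^sup>2)"
    "\<bar>dalembert (gram w) s (t - h) h\<bar> \<le> \<epsilon> * (tent F s h + h\<^sup>2)"
    "\<bar>dalembert (gram w) (s + h) t h\<bar> \<le> \<epsilon> * (tent F (s + h) h + h\<^sup>2)"
    "\<bar>dalembert (gram w) (s - h) t h\<bar> \<le> \<epsilon> * (tent F (s - h) h + h\<^sup>2)"
    by (rule small; use h st in simp)+
  moreover have "\<epsilon> * (tent F s (2 * h) + (2 * h)\<^sup>2) = \<epsilon> * (tent F s h + h\<^sup>2) + \<epsilon> * (tent F s h + h\<^sup>2)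
      + \<epsilon> * (tent F (s + h) h + h\<^sup>2) + \<epsilon> * (tent F (s - h) h + h\<^sup>2)"
    unfolding tent_double[OF F_cont h] by (simp add: algebra_simps)
  ultimately show ?thesis by linarith
qed

text \<open>
  The diamond is cut into \<open>4\<^sup>n\<close> diamonds small enough for the preceding estimate. All of them stay at
  distance at least \<open>\<sigma> = s - h > 0\<close> from the axis, so that their size can also be made less than \<open>\<sigma>\<close>.
\<close>

lemma diamond_zero_interior:
  assumes h: "0 \<le> h" "h < s" "s + h \<le> t" "s + t + h \<le> R"
  shows "dalembert (gram w) s t h = 0"
proof -
  have "\<bar>dalembert (gram w) s t h\<bar> \<le> \<epsilon> * (tent F s h + h\<^sup>2)" if "0 < \<epsilon>" for \<epsilon>
  proof -
    define \<sigma> where "\<sigma> = s - h"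
    from small_diamonds[OF that] obtain \<delta> where \<delta>: "0 < \<delta>"
      "\<And>h s t. 0 \<le> h \<Longrightarrow> h \<le> \<delta> \<Longrightarrow> 2 * h \<le> s \<Longrightarrow> s + h \<le> t \<Longrightarrow> s + t + h \<le> R \<Longrightarrow>
       \<bar>dalembert (gram w) s t h\<bar> \<le> \<epsilon> * (tent F s h + h\<^sup>2)" by blast
    have "0 < min \<delta> \<sigma>" using \<delta> h by (simp add: \<sigma>_def)
    obtain n where "h / min \<delta> \<sigma> < 2 ^ n"
      using real_arch_pow[of 2 "h / min \<delta> \<sigma>"] by auto
    with \<open>0 < min \<delta> \<sigma>\<close> have n: "h \<le> 2 ^ n * min \<delta> \<sigma>" by (simp add: field_simps)
    have "\<bar>dalembert (gram w) s t (2 ^ n * k)\<bar> \<le> \<epsilon> * (tent F s (2 ^ n * k) + (2 ^ n * k)\<^sup>2)"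
      if "0 \<le> k" "k \<le> min \<delta> \<sigma>" "\<sigma> \<le> s - 2 ^ n * k" "s + 2 ^ n * k \<le> t" "s + t + 2 ^ n * k \<le> R" for n k s t
      using that
    proof (induction n arbitrary: s t)
      case 0
      then show ?case using \<delta>(2)[of k s t] by simp
    next
      case (Suc n)
      show ?case
        using diamond_doubling[of \<sigma> "2 ^ n * k" \<epsilon> s t] Suc
        by (simp add: mult.assoc)
    qed
    from this[where n = n and k = "h / 2 ^ n" and s = s and t = t]
    have "h / 2 ^ n \<le> min \<delta> \<sigma> \<Longrightarrow> ?thesis" using h by (simp add: \<sigma>_def)
    moreover have "h / 2 ^ n \<le> min \<delta> \<sigma>"
      using n by (simp add: divide_le_eq mult.commute del: min_less_iff_conj min.bounded_iff)
    ultimately show ?thesis by blast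
  qed
  hence "\<bar>dalembert (gram w) s t h\<bar> \<le> 0"
  proof (cases "tent F s h + h\<^sup>2 = 0")
    case False
    let ?m = "tent F s h + h\<^sup>2"
    have m: "0 < ?m" using tent_nonneg[OF F_mono, of s h] False
      by (metis add_nonneg_nonneg less_eq_real_def zero_le_power2)
    show ?thesis
    proof (rule field_le_epsilon)
      fix e :: real assume "0 < e"
      thus "\<bar>dalembert (gram w) s t h\<bar> \<le> 0 + e"
        using \<open>\<And>\<epsilon>. 0 < \<epsilon> \<Longrightarrow> \<bar>dalembert (gram w) s t h\<bar> \<le> \<epsilon> * ?m\<close>[of "e / ?m"] m by simp
    qed
  qed (use \<open>\<And>\<epsilon>. 0 < \<epsilon> \<Longrightarrow> \<bar>dalembert (gram w) s t h\<bar> \<le> \<epsilon> * (tent F s h + h\<^sup>2)\<close>[of 1] in simp)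
  thus ?thesis by simp
qed

lemma gram_zero: "0 \<le> t \<Longrightarrow> t \<le> R \<Longrightarrow> gram w 0 t = 0"
  by (simp add: gram_def correlation_def w_zero)

text \<open>
  Diamonds touching the axis \<open>s = 0\<close> are limits of diamonds inside.
\<close>

lemma diamond_zero:
  assumes h: "0 \<le> h" "h \<le> s" "s + h \<le> t" "s + t + h \<le> R"
  shows "dalembert (gram w) s t h = 0"
proof (cases "h < s")
  case False
  hence hs: "h = s" using h by simp
  show ?thesis
  proof (cases "s = 0")
    case False
    let ?f = "\<lambda>k. dalembert (gram w) s t k"
    have "continuous_on {0..s} ?f"
      unfolding dalembert_def by (intro continuous_intros) (use h in auto)
    moreover have "closure {0..<s} = {0..s}" using False h by simp
    moreover have "?f k = 0" if "k \<in> {0..<s}" for k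
      by (rule diamond_zero_interior) (use that h hs in auto)
    ultimately show ?thesis
      using continuous_constant_on_closure[of "{0..<s}" ?f 0 s] hs h by auto
  qed (simp add: hs dalembert_def)
qed (use diamond_zero_interior h in simp)

text \<open>
  A function whose discrete wave operator vanishes and which is \<open>o(s)\<close> at the axis is zero: the
  triangle below \<open>(2 * s, t)\<close> consists of a diamond and the triangles below \<open>(s, t + s)\<close> and
  \<open>(s, t - s)\<close>, so a bound \<open>\<epsilon> * s\<close> passes from small to large \<open>s\<close>.
\<close>

lemma gram_eq_dalembert_solution:
  assumes bottom: "\<And>\<epsilon>. 0 < \<epsilon> \<Longrightarrow> \<exists>\<delta>>0. \<forall>s t. 0 \<le> s \<longrightarrow> s \<le> \<delta> \<longrightarrow> s \<le> t \<longrightarrow> s + t \<le> R \<longrightarrow>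
      \<bar>gram w s t - (P (t + s) - P (t - s))\<bar> \<le> \<epsilon> * s"
    and st: "0 \<le> s" "s \<le> t" "s + t \<le> R"
  shows "gram w s t = P (t + s) - P (t - s)"
proof -
  define E where "E s t = gram w s t - (P (t + s) - P (t - s))" for s t
  have dbl: "E (2 * s) t = E s (t + s) + E s (t - s)" if "0 \<le> s" "2 * s \<le> t" "2 * s + t \<le> R" for s t
  proof -
    have "dalembert (gram w) s t s = 0" by (rule diamond_zero) (use that in auto)
    moreover have "gram w 0 t = 0" by (rule gram_zero) (use that in auto)
    ultimately show ?thesis by (simp add: dalembert_def E_def algebra_simps)
  qed
  have "\<bar>E s t\<bar> \<le> \<epsilon> * s" if "0 < \<epsilon>" for \<epsilon>
  proof -
    from bottom[OF that] obtain \<delta> where \<delta>: "0 < \<delta>"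
      "\<And>s t. 0 \<le> s \<Longrightarrow> s \<le> \<delta> \<Longrightarrow> s \<le> t \<Longrightarrow> s + t \<le> R \<Longrightarrow> \<bar>E s t\<bar> \<le> \<epsilon> * s"
      unfolding E_def by blast
    obtain n where "s / \<delta> < 2 ^ n" using real_arch_pow[of 2 "s / \<delta>"] by auto
    with \<delta> have n: "s \<le> 2 ^ n * \<delta>" by (simp add: field_simps)
    have "\<bar>E (2 ^ n * k) t\<bar> \<le> \<epsilon> * (2 ^ n * k)"
      if "0 \<le> k" "k \<le> \<delta>" "2 ^ n * k \<le> t" "2 ^ n * k + t \<le> R" for n k t
      using that
    proof (induction n arbitrary: t)
      case 0
      then show ?case using \<delta>(2)[of k t] by simp
    next
      case (Suc n)
      let ?s = "2 ^ n * k"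
      have s0: "0 \<le> ?s" "2 * ?s \<le> t" "2 * ?s + t \<le> R"
        using Suc.prems by (simp_all add: mult.assoc)
      have "\<bar>E ?s (t + ?s)\<bar> \<le> \<epsilon> * ?s" "\<bar>E ?s (t - ?s)\<bar> \<le> \<epsilon> * ?s"
        by (rule Suc.IH; use Suc.prems(1,2) s0 in linarith)+
      moreover have "E (2 * ?s) t = E ?s (t + ?s) + E ?s (t - ?s)"
        by (rule dbl) (use s0 in auto)
      ultimately have "\<bar>E (2 * ?s) t\<bar> \<le> \<epsilon> * (2 * ?s)" by linarith
      thus ?case by (simp add: mult.assoc)
    qed
    from this[where n = n and k = "s / 2 ^ n" and t = t] show ?thesis using n st by (simp add: field_simps)
  qed
  have "\<bar>E s t\<bar> \<le> 0"
  proof (rule field_le_epsilon)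
    fix e :: real assume e: "0 < e"
    have "\<bar>E s t\<bar> \<le> e / (s + 1) * s" using \<open>\<And>\<epsilon>. 0 < \<epsilon> \<Longrightarrow> \<bar>E s t\<bar> \<le> \<epsilon> * s\<close>[of "e / (s + 1)"] st e by simp
    also have "\<dots> \<le> 0 + e" using st e by (simp add: field_simps)
    finally show "\<bar>E s t\<bar> \<le> 0 + e" .
  qed
  thus ?thesis by (simp add: E_def)
qed

end

section \<open>Integrals of integrable functions on the line\<close>

lemma integrable_on_interval: "f integrable_on {a..b}" if "integrable lborel f" for f :: "real \<Rightarrow> real"
  using integrable_on_lborel[OF that] integrable_on_subinterval by blast

lemma integral_interval_lborel:
  "integral {a..b} f = (\<integral>x. indicator {a..b} x * f x \<partial>lborel)" if "integrable lborel f" for f :: "real \<Rightarrow> real"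
proof -
  have "set_integrable lborel {a..b} f"
    unfolding set_integrable_def using that by (intro integrable_mult_indicator) auto
  from set_borel_integral_eq_integral(2)[OF this] show ?thesis
    by (simp add: set_lebesgue_integral_def)
qed

lemma primitive_diff:
  fixes f :: "real \<Rightarrow> real"
  assumes f: "integrable lborel f" and ab: "a \<le> b"
  shows "(\<integral>y. indicator {..b} y * f y \<partial>lborel) - (\<integral>y. indicator {..a} y * f y \<partial>lborel) = integral {a..b} f"
proof -
  have i: "integrable lborel (\<lambda>y. indicator S y * f y)" if "S \<in> sets borel" for S
    using integrable_mult_indicator[of S lborel f] f that by simp
  have [measurable]: "f \<in> borel_measurable borel" using f by auto
  have "(\<integral>y. indicator {..b} y * f y \<partial>lborel) - (\<integral>y. indicator {..a} y * f y \<partial>lborel)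
     = (\<integral>y. indicator {..b} y * f y - indicator {..a} y * f y \<partial>lborel)"
    by (subst Bochner_Integration.integral_diff) (auto intro: i)
  also have "\<dots> = (\<integral>y. indicator {a..b} y * f y \<partial>lborel)"
  proof (rule integral_cong_AE)
    have "AE y in lborel. y \<noteq> a" by (rule AE_lborel_singleton)
    thus "AE y in lborel. indicator {..b} y * f y - indicator {..a} y * f y = indicator {a..b} y * f y"
      by eventually_elim (use ab in \<open>auto simp: indicator_def\<close>)
  qed auto
  finally show ?thesis by (simp add: integral_interval_lborel[OF f])
qed

lemma primitive_continuous:
  fixes f :: "real \<Rightarrow> real"
  assumes f: "integrable lborel f"
  shows "continuous_on UNIV (\<lambda>x. \<integral>y. indicator {..x} y * f y \<partial>lborel)" (is "continuous_on UNIV ?P")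
proof (rule continuous_at_imp_continuous_on, intro ballI)
  fix x
  have "continuous_on {x - 1..x + 1} (\<lambda>z. ?P (x - 1) + integral {x - 1..z} f)"
    by (rule continuous_on_add[OF continuous_on_const indefinite_integral_continuous_1[OF integrable_on_interval[OF f]]])
  hence "continuous_on {x - 1..x + 1} ?P"
  proof (rule continuous_on_eq)
    fix z assume "z \<in> {x - 1..x + 1}"
    thus "?P (x - 1) + integral {x - 1..z} f = ?P z" using primitive_diff[OF f, of "x - 1" z] by simp
  qed
  hence "continuous_on {x - 1<..<x + 1} ?P" by (rule continuous_on_subset) auto
  thus "isCont ?P x" by (simp add: continuous_on_eq_continuous_at)
qed

lemma integral_affine_half:
  fixes f :: "real \<Rightarrow> real"
  assumes "integrable lborel f"
  shows "integral {c..d} (\<lambda>\<eta>. f ((\<eta> - \<xi>) / 2)) = 2 * integral {(c - \<xi>) / 2..(d - \<xi>) / 2} f"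
proof -
  have "(f has_integral integral {(c - \<xi>) / 2..(d - \<xi>) / 2} f) (cbox ((c - \<xi>) / 2) ((d - \<xi>) / 2))"
    using integrable_on_interval[OF assms] by auto
  from has_integral_affinity_iff[THEN iffD2, OF _ this, of "1 / 2" "- \<xi> / 2"]
  have "((\<lambda>\<eta>. f ((\<eta> - \<xi>) / 2)) has_integral 2 * integral {(c - \<xi>) / 2..(d - \<xi>) / 2} f) {c..d}"
    by (simp add: field_simps)
  thus ?thesis by (rule integral_unique)
qed

lemma set_integrable_interval: "set_integrable lborel {a..b} f" if "integrable lborel f" for f :: "real \<Rightarrow> real"
  unfolding set_integrable_def using that by (intro integrable_mult_indicator) auto

text \<open>
  Fubini's theorem for iterated gauge integrals over a rectangle; joint integrability comes from
  the uniform bound for the inner integrals.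
\<close>

lemma integral_swap:
  fixes f :: "real \<Rightarrow> real \<Rightarrow> real"
  assumes f [measurable]: "(\<lambda>(x, y). f x y) \<in> borel_measurable (borel \<Otimes>\<^sub>M borel)"
    and fx: "\<And>x. x \<in> {a..b} \<Longrightarrow> set_integrable lborel {c..d} (f x)"
    and fy: "\<And>y. y \<in> {c..d} \<Longrightarrow> set_integrable lborel {a..b} (\<lambda>x. f x y)"
    and B: "\<And>x. x \<in> {a..b} \<Longrightarrow> (LINT y:{c..d}|lborel. \<bar>f x y\<bar>) \<le> B"
  shows "integral {a..b} (\<lambda>x. integral {c..d} (f x)) = integral {c..d} (\<lambda>y. integral {a..b} (\<lambda>x. f x y))"
proof -
  define h where "h x y = indicator {a..b} x * (indicator {c..d} y * f x y)" for x y
  have [measurable]: "(\<lambda>(x, y). h x y) \<in> borel_measurable (lborel \<Otimes>\<^sub>M lborel)"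
    unfolding h_def by measurable
  have hx: "integrable lborel (h x)" for x
    using fx[of x] by (cases "x \<in> {a..b}") (simp_all add: h_def[abs_def] set_integrable_def)
  have B0: "0 \<le> (LINT y:{c..d}|lborel. \<bar>f x y\<bar>)" for x
    unfolding set_lebesgue_integral_def by (rule Bochner_Integration.integral_nonneg) simp
  have int: "integrable (lborel \<Otimes>\<^sub>M lborel) (\<lambda>(x, y). h x y)"
  proof (rule lborel_pair.Fubini_integrable)
    show "integrable lborel (\<lambda>x. \<integral>y. norm (case (x, y) of (x, y) \<Rightarrow> h x y) \<partial>lborel)"
    proof (rule Bochner_Integration.integrable_bound)
      show "integrable lborel (\<lambda>x. B * indicator {a..b} x)"
        by (intro integrable_mult_right) (auto simp: emeasure_lborel_Icc_eq)
      have "\<bar>\<integral>y. \<bar>h x y\<bar> \<partial>lborel\<bar> \<le> \<bar>B * indicator {a..b} x\<bar>" for x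
        using B[of x] B0[of x]
        by (cases "x \<in> {a..b}") (simp_all add: h_def abs_mult set_lebesgue_integral_def)
      thus "AE x in lborel. norm (\<integral>y. norm (case (x, y) of (x, y) \<Rightarrow> h x y) \<partial>lborel) \<le> norm (B * indicator {a..b} x)"
        by simp
    qed simp
  qed (auto intro: hx)
  have 1: "(\<integral>x. \<integral>y. h x y \<partial>lborel \<partial>lborel) = integral {a..b} (\<lambda>x. integral {c..d} (f x))"
  proof -
    have *: "(\<integral>y. h x y \<partial>lborel) = indicator {a..b} x *\<^sub>R integral {c..d} (f x)" for x
      using set_borel_integral_eq_integral(2)[OF fx, of x]
      by (cases "x \<in> {a..b}") (simp_all add: h_def set_lebesgue_integral_def)
    have "integrable lborel (\<lambda>x. \<integral>y. h x y \<partial>lborel)"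
      using lborel_pair.integrable_fst[OF int] by simp
    hence "set_integrable lborel {a..b} (\<lambda>x. integral {c..d} (f x))"
      by (simp only: * set_integrable_def)
    from set_borel_integral_eq_integral(2)[OF this] show ?thesis
      by (simp only: * set_lebesgue_integral_def)
  qed
  have 2: "(\<integral>y. \<integral>x. h x y \<partial>lborel \<partial>lborel) = integral {c..d} (\<lambda>y. integral {a..b} (\<lambda>x. f x y))"
  proof -
    have *: "(\<integral>x. h x y \<partial>lborel) = indicator {c..d} y *\<^sub>R integral {a..b} (\<lambda>x. f x y)" for y
      using set_borel_integral_eq_integral(2)[OF fy, of y]
      by (cases "y \<in> {c..d}") (simp_all add: h_def set_lebesgue_integral_def mult.left_commute)
    have "integrable lborel (\<lambda>y. \<integral>x. h x y \<partial>lborel)"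
      using lborel_pair.integrable_snd[OF int] by simp
    hence "set_integrable lborel {c..d} (\<lambda>y. integral {a..b} (\<lambda>x. f x y))"
      by (simp only: * set_integrable_def)
    from set_borel_integral_eq_integral(2)[OF this] show ?thesis
      by (simp only: * set_lebesgue_integral_def)
  qed
  show ?thesis using lborel_pair.Fubini_integral[OF int] 1 2 by simp
qed

lemma bounded_measurable_set_integrable:
  fixes f :: "real \<Rightarrow> real"
  assumes [measurable]: "f \<in> borel_measurable borel" and "\<And>x. x \<in> {a..b} \<Longrightarrow> \<bar>f x\<bar> \<le> B"
  shows "set_integrable lborel {a..b} f"
  unfolding set_integrable_def
proof (rule Bochner_Integration.integrable_bound)
  show "integrable lborel (\<lambda>x. B * indicator {a..b} x)"
    by (intro integrable_mult_right) (auto simp: emeasure_lborel_Icc_eq)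
qed (use assms in \<open>auto simp: indicator_def intro!: AE_I2 order_trans[OF _ abs_ge_self]\<close>)

section \<open>The Goursat problem\<close>

text \<open>
  For a Borel function \<open>q\<close> and a bounded continuous \<open>v\<close> on the plane, the integrand of the
  Goursat equation is jointly measurable, and integrable over the line in each variable.
\<close>

locale bounded_kernel =
  fixes q :: "real \<Rightarrow> real" and v :: "real \<Rightarrow> real \<Rightarrow> real" and C :: real
  assumes q_meas [measurable]: "q \<in> borel_measurable borel"
    and q_int: "integrable lborel q"
    and v_cont: "continuous_on UNIV (\<lambda>(\<xi>, \<eta>). v \<xi> \<eta>)"
    and v_le: "\<And>\<xi> \<eta>. \<bar>v \<xi> \<eta>\<bar> \<le> C"
begin

lemma v_meas [measurable]: "(\<lambda>(\<xi>, \<eta>). v \<xi> \<eta>) \<in> borel_measurable (borel \<Otimes>\<^sub>M borel)"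
  unfolding borel_prod by (rule borel_measurable_continuous_onI[OF v_cont])

lemma C_nonneg: "0 \<le> C"
  using v_le[of 0 0] by linarith

text \<open>
  Primitives starting at \<open>-\<infinity>\<close>, so that \<open>F\<close> has values between \<open>0\<close> and \<open>N\<close>.
\<close>

definition G :: "real \<Rightarrow> real" where "G x = (\<integral>y. indicator {..x} y * q y \<partial>lborel)"
definition F :: "real \<Rightarrow> real" where "F x = (\<integral>y. indicator {..x} y * \<bar>q y\<bar> \<partial>lborel)"
definition N :: real where "N = (\<integral>y. \<bar>q y\<bar> \<partial>lborel)"

lemma abs_q_int: "integrable lborel (\<lambda>x. \<bar>q x\<bar>)"
  using q_int by (rule integrable_abs)

lemma G_diff: "a \<le> b \<Longrightarrow> G b - G a = integral {a..b} q"
  unfolding G_def by (rule primitive_diff[OF q_int])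
lemma F_diff: "a \<le> b \<Longrightarrow> F b - F a = integral {a..b} (\<lambda>x. \<bar>q x\<bar>)"
  unfolding F_def by (rule primitive_diff[OF abs_q_int])
lemma G_cont: "continuous_on UNIV G"
  using primitive_continuous[OF q_int] by (simp add: G_def[abs_def])
lemma F_cont: "continuous_on UNIV F"
  using primitive_continuous[OF abs_q_int] by (simp add: F_def[abs_def])

lemma F_mono: "mono F"
proof
  fix a b :: real assume "a \<le> b"
  have "0 \<le> integral {a..b} (\<lambda>x. \<bar>q x\<bar>)"
    by (rule integral_nonneg) (auto intro: integrable_on_interval abs_q_int)
  thus "F a \<le> F b" using F_diff[OF \<open>a \<le> b\<close>] by simp
qed

lemma F_nonneg: "0 \<le> F x"
  unfolding F_def by (rule Bochner_Integration.integral_nonneg) auto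

lemma F_le: "F x \<le> N"
  unfolding F_def N_def
proof (rule integral_mono)
  show "integrable lborel (\<lambda>y. indicator {..x} y * \<bar>q y\<bar>)"
    using integrable_mult_indicator[of "{..x}" lborel "\<lambda>x. \<bar>q x\<bar>"] abs_q_int by simp
qed (auto intro: abs_q_int simp: indicator_def)

lemma G_le_F: "a \<le> b \<Longrightarrow> \<bar>G b - G a\<bar> \<le> F b - F a"
  using integral_norm_bound_integral[of q "{a..b}" "\<lambda>x. \<bar>q x\<bar>"] integrable_on_interval[OF q_int]
    integrable_on_interval[OF abs_q_int] by (simp add: G_diff F_diff)

definition integrand :: "real \<Rightarrow> real \<Rightarrow> real" where "integrand \<xi> \<eta> = q ((\<eta> - \<xi>) / 2) * v \<xi> \<eta>"
definition eta_integral :: "real \<Rightarrow> real \<Rightarrow> real \<Rightarrow> real" where "eta_integral \<xi> c d = integral {c..d} (integrand \<xi>)"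

lemma integrand_meas [measurable]: "(\<lambda>(\<xi>, \<eta>). integrand \<xi> \<eta>) \<in> borel_measurable (borel \<Otimes>\<^sub>M borel)"
  unfolding integrand_def by measurable

lemma q_affine: "integrable lborel (\<lambda>\<eta>. q ((\<eta> - \<xi>) / 2))" "integrable lborel (\<lambda>\<xi>. q ((\<eta> - \<xi>) / 2))"
  using lborel_integrable_real_affine[OF q_int, of "1 / 2" "- \<xi> / 2"]
    lborel_integrable_real_affine[OF q_int, of "- 1 / 2" "\<eta> / 2"]
  by (simp_all add: field_simps)

lemma integrand_int: "integrable lborel (integrand \<xi>)"
proof (rule Bochner_Integration.integrable_bound)
  show "integrable lborel (\<lambda>\<eta>. C * \<bar>q ((\<eta> - \<xi>) / 2)\<bar>)"
    by (intro integrable_mult_right integrable_abs q_affine)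
  show "AE \<eta> in lborel. norm (integrand \<xi> \<eta>) \<le> norm (C * \<bar>q ((\<eta> - \<xi>) / 2)\<bar>)"
    by (intro AE_I2) (simp add: integrand_def abs_mult mult.commute C_nonneg mult_right_mono v_le)
qed measurable

lemma integrand_int': "integrable lborel (\<lambda>\<xi>. integrand \<xi> \<eta>)"
proof (rule Bochner_Integration.integrable_bound)
  show "integrable lborel (\<lambda>\<xi>. C * \<bar>q ((\<eta> - \<xi>) / 2)\<bar>)"
    by (intro integrable_mult_right integrable_abs q_affine)
  show "AE \<xi> in lborel. norm (integrand \<xi> \<eta>) \<le> norm (C * \<bar>q ((\<eta> - \<xi>) / 2)\<bar>)"
    by (intro AE_I2) (simp add: integrand_def abs_mult mult.commute C_nonneg mult_right_mono v_le)
qed measurable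

text \<open>
  Freezing \<open>v\<close> at a value \<open>v0\<close> leaves an increment of the primitive of \<open>q\<close>. With \<open>v0 = 0\<close> and \<open>\<omega> = C\<close>
  this is also the basic bound for the inner integral.
\<close>

lemma eta_integral_freeze:
  assumes cd: "c \<le> d" and osc: "\<And>\<eta>. c \<le> \<eta> \<Longrightarrow> \<eta> \<le> d \<Longrightarrow> \<bar>v \<xi> \<eta> - v0\<bar> \<le> \<omega>"
  shows "\<bar>eta_integral \<xi> c d - v0 * (2 * (G ((d - \<xi>) / 2) - G ((c - \<xi>) / 2)))\<bar>
     \<le> \<omega> * (2 * (F ((d - \<xi>) / 2) - F ((c - \<xi>) / 2)))"
proof -
  have le: "(c - \<xi>) / 2 \<le> (d - \<xi>) / 2" using cd by simp
  have i: "(\<lambda>\<eta>. q ((\<eta> - \<xi>) / 2)) integrable_on {c..d}" by (rule integrable_on_interval[OF q_affine(1)])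
  have ia: "(\<lambda>\<eta>. \<bar>q ((\<eta> - \<xi>) / 2)\<bar>) integrable_on {c..d}"
    by (rule integrable_on_interval[OF integrable_abs[OF q_affine(1)]])
  have ig: "integrand \<xi> integrable_on {c..d}" by (rule integrable_on_interval[OF integrand_int])
  have "eta_integral \<xi> c d - v0 * (2 * (G ((d - \<xi>) / 2) - G ((c - \<xi>) / 2)))
      = eta_integral \<xi> c d - v0 * integral {c..d} (\<lambda>\<eta>. q ((\<eta> - \<xi>) / 2))"
    using integral_affine_half[OF q_int] G_diff[OF le] by simp
  also have "\<dots> = integral {c..d} (\<lambda>\<eta>. integrand \<xi> \<eta> - v0 * q ((\<eta> - \<xi>) / 2))"
    unfolding eta_integral_def integral_mult_right[symmetric]
    by (rule integral_diff[symmetric]) (auto intro: ig integrable_on_mult_right i)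
  also have "\<bar>\<dots>\<bar> \<le> integral {c..d} (\<lambda>\<eta>. \<omega> * \<bar>q ((\<eta> - \<xi>) / 2)\<bar>)"
    unfolding real_norm_def[symmetric]
  proof (rule integral_norm_bound_integral)
    fix \<eta> assume "\<eta> \<in> {c..d}"
    hence "\<bar>q ((\<eta> - \<xi>) / 2)\<bar> * \<bar>v \<xi> \<eta> - v0\<bar> \<le> \<bar>q ((\<eta> - \<xi>) / 2)\<bar> * \<omega>"
      by (intro mult_left_mono osc) auto
    thus "norm (integrand \<xi> \<eta> - v0 * q ((\<eta> - \<xi>) / 2)) \<le> \<omega> * norm (q ((\<eta> - \<xi>) / 2))"
      unfolding abs_mult[symmetric] real_norm_def by (simp add: integrand_def algebra_simps)
  qed (use ig i ia in \<open>auto intro!: integrable_diff integrable_on_mult_right\<close>)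
  also have "\<dots> = \<omega> * (2 * (F ((d - \<xi>) / 2) - F ((c - \<xi>) / 2)))"
    using integral_affine_half[OF abs_q_int] F_diff[OF le] by simp
  finally show ?thesis .
qed

lemma eta_integral_add: "c \<le> d \<Longrightarrow> d \<le> e \<Longrightarrow> eta_integral \<xi> c d + eta_integral \<xi> d e = eta_integral \<xi> c e"
  unfolding eta_integral_def
  by (rule Henstock_Kurzweil_Integration.integral_combine) (auto intro: integrable_on_interval integrand_int)

lemma eta_integral_bound: "\<bar>eta_integral \<xi> c d\<bar> \<le> 2 * C * N"
proof (cases "c \<le> d")
  case True
  have "\<bar>eta_integral \<xi> c d\<bar> \<le> C * (2 * (F ((d - \<xi>) / 2) - F ((c - \<xi>) / 2)))"
    using eta_integral_freeze[OF True, of \<xi> 0 C] v_le by simp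
  also have "\<dots> \<le> C * (2 * N)"
    using F_le[of "(d - \<xi>) / 2"] F_nonneg[of "(c - \<xi>) / 2"] C_nonneg by (intro mult_left_mono) auto
  finally show ?thesis by simp
next
  case False
  thus ?thesis using C_nonneg F_nonneg[of 0] F_le[of 0] by (simp add: eta_integral_def)
qed

lemma eta_integral_set_integrable: "set_integrable lborel {a..b} (\<lambda>\<xi>. eta_integral \<xi> c d)"
proof (rule bounded_measurable_set_integrable[OF _ eta_integral_bound])
  show "(\<lambda>\<xi>. eta_integral \<xi> c d) \<in> borel_measurable borel"
    unfolding eta_integral_def integral_interval_lborel[OF integrand_int] by measurable
qed

lemma eta_integral_integrable: "(\<lambda>\<xi>. eta_integral \<xi> c d) integrable_on {a..b}"
  by (rule set_borel_integral_eq_integral(1)[OF eta_integral_set_integrable])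

end

text \<open>
  The function \<open>v\<close>, given for \<open>\<xi> \<le> \<eta>\<close>, is extended antisymmetrically across the diagonal, which is the
  line \<open>x = 0\<close>.
\<close>

locale goursat_data = bounded_kernel +
  fixes R :: real
  assumes v_antisym: "\<And>\<xi> \<eta>. 0 \<le> \<xi> \<Longrightarrow> \<xi> \<le> R \<Longrightarrow> 0 \<le> \<eta> \<Longrightarrow> \<eta> \<le> R \<Longrightarrow> v \<eta> \<xi> = - v \<xi> \<eta>"
    and goursat: "\<And>\<xi> \<eta>. 0 \<le> \<xi> \<Longrightarrow> \<xi> \<le> \<eta> \<Longrightarrow> \<eta> \<le> R \<Longrightarrow>
      v \<xi> \<eta> = - (1 / 2) * integral {\<xi> / 2..\<eta> / 2} q
        - (1 / 4) * integral {0..\<xi>} (\<lambda>\<xi>1. integral {\<xi>..\<eta>} (\<lambda>\<eta>1. q ((\<eta>1 - \<xi>1) / 2) * v \<xi>1 \<eta>1))"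
begin

lemma goursat_inner:
  "0 \<le> \<xi> \<Longrightarrow> \<xi> \<le> \<eta> \<Longrightarrow> \<eta> \<le> R \<Longrightarrow>
    v \<xi> \<eta> = - (1 / 2) * integral {\<xi> / 2..\<eta> / 2} q - (1 / 4) * integral {0..\<xi>} (\<lambda>\<xi>1. eta_integral \<xi>1 \<xi> \<eta>)"
  using goursat[of \<xi> \<eta>] by (simp add: eta_integral_def integrand_def[abs_def])

lemma v_diag: "0 \<le> \<xi> \<Longrightarrow> \<xi> \<le> R \<Longrightarrow> v \<xi> \<xi> = 0"
  using v_antisym[of \<xi> \<xi>] by simp

lemma v_increment:
  assumes "0 \<le> \<xi>" "\<xi> \<le> \<eta>" "\<eta> \<le> \<eta>'" "\<eta>' \<le> R"
  shows "v \<xi> \<eta>' - v \<xi> \<eta> = - (1 / 2) * (G (\<eta>' / 2) - G (\<eta> / 2)) - 1 / 4 * integral {0..\<xi>} (\<lambda>\<xi>1. eta_integral \<xi>1 \<eta> \<eta>')"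
proof -
  have "integral {0..\<xi>} (\<lambda>\<xi>1. eta_integral \<xi>1 \<xi> \<eta>') = integral {0..\<xi>} (\<lambda>\<xi>1. eta_integral \<xi>1 \<xi> \<eta> + eta_integral \<xi>1 \<eta> \<eta>')"
    using assms by (intro integral_cong) (simp add: eta_integral_add)
  also have "\<dots> = integral {0..\<xi>} (\<lambda>\<xi>1. eta_integral \<xi>1 \<xi> \<eta>) + integral {0..\<xi>} (\<lambda>\<xi>1. eta_integral \<xi>1 \<eta> \<eta>')"
    by (rule integral_add) (rule eta_integral_integrable)+
  moreover have "integral {\<xi> / 2..\<eta>' / 2} q = integral {\<xi> / 2..\<eta> / 2} q + (G (\<eta>' / 2) - G (\<eta> / 2))"
    using assms G_diff[of "\<xi> / 2" "\<eta>' / 2"] G_diff[of "\<xi> / 2" "\<eta> / 2"] by simp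
  ultimately show ?thesis
    using goursat_inner[of \<xi> \<eta>'] goursat_inner[of \<xi> \<eta>] assms by (simp add: algebra_simps)
qed

text \<open>
  The wave equation in characteristic coordinates, integrated over a rectangle.
\<close>

lemma rectangle:
  assumes "0 \<le> \<xi>" "\<xi> \<le> \<xi>'" "\<xi>' \<le> \<eta>" "\<eta> \<le> \<eta>'" "\<eta>' \<le> R"
  shows "v \<xi>' \<eta>' - v \<xi> \<eta>' - v \<xi>' \<eta> + v \<xi> \<eta> = - 1 / 4 * integral {\<xi>..\<xi>'} (\<lambda>\<xi>1. eta_integral \<xi>1 \<eta> \<eta>')"
proof -
  have "integral {0..\<xi>} (\<lambda>\<xi>1. eta_integral \<xi>1 \<eta> \<eta>') + integral {\<xi>..\<xi>'} (\<lambda>\<xi>1. eta_integral \<xi>1 \<eta> \<eta>') = integral {0..\<xi>'} (\<lambda>\<xi>1. eta_integral \<xi>1 \<eta> \<eta>')"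
    by (rule Henstock_Kurzweil_Integration.integral_combine) (use assms eta_integral_integrable in auto)
  thus ?thesis using v_increment[of \<xi> \<eta> \<eta>'] v_increment[of \<xi>' \<eta> \<eta>'] assms by simp
qed

lemma eta_integral_integral_bound:
  assumes "\<xi> \<le> \<xi>'" "\<eta> \<le> \<eta>'"
  shows "\<bar>integral {\<xi>..\<xi>'} (\<lambda>\<xi>1. eta_integral \<xi>1 \<eta> \<eta>')\<bar> \<le> 2 * C * (\<xi>' - \<xi>) * (F ((\<eta>' - \<xi>) / 2) - F ((\<eta> - \<xi>') / 2))"
proof -
  let ?b = "C * (2 * (F ((\<eta>' - \<xi>) / 2) - F ((\<eta> - \<xi>') / 2)))"
  have "\<bar>integral {\<xi>..\<xi>'} (\<lambda>\<xi>1. eta_integral \<xi>1 \<eta> \<eta>')\<bar> \<le> integral {\<xi>..\<xi>'} (\<lambda>_. ?b)"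
    unfolding real_norm_def[symmetric]
  proof (rule integral_norm_bound_integral)
    fix \<xi>1 assume \<xi>1: "\<xi>1 \<in> {\<xi>..\<xi>'}"
    have "\<bar>eta_integral \<xi>1 \<eta> \<eta>'\<bar> \<le> C * (2 * (F ((\<eta>' - \<xi>1) / 2) - F ((\<eta> - \<xi>1) / 2)))"
      using eta_integral_freeze[OF assms(2), of \<xi>1 0 C] v_le by simp
    also have "\<dots> \<le> ?b"
    proof -
      have "F ((\<eta>' - \<xi>1) / 2) \<le> F ((\<eta>' - \<xi>) / 2)" "F ((\<eta> - \<xi>') / 2) \<le> F ((\<eta> - \<xi>1) / 2)"
        using \<xi>1 by (auto intro!: monoD[OF F_mono])
      thus ?thesis using C_nonneg by (intro mult_left_mono) auto
    qed
    finally show "norm (eta_integral \<xi>1 \<eta> \<eta>') \<le> ?b" by simp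
  qed (auto intro: eta_integral_integrable)
  thus ?thesis using assms by (simp add: algebra_simps)
qed

abbreviation w :: "real \<Rightarrow> real \<Rightarrow> real" where "w \<equiv> wave_kernel v"

lemma w_interior:
  assumes "0 \<le> h" "h \<le> x" "x + h \<le> t" "x + t + h \<le> R"
    and osc: "\<And>y \<tau>. \<bar>y - x\<bar> \<le> h \<Longrightarrow> \<bar>\<tau> - t\<bar> \<le> h \<Longrightarrow> 0 \<le> y \<Longrightarrow> y \<le> \<tau> \<Longrightarrow> y + \<tau> \<le> R \<Longrightarrow> \<bar>w y \<tau> - w x t\<bar> \<le> \<omega>"
  shows "\<bar>dalembert w x t h - 1 / 4 * w x t * tent G x h\<bar> \<le> 1 / 4 * \<omega> * tent F x h"
proof -
  define \<xi> \<eta> where "\<xi> = t - x" and "\<eta> = t + x"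
  let ?I = "integral {\<xi> - h..\<xi> + h}"
  note [continuous_intros] = continuous_on_UNIV_compose[OF G_cont] continuous_on_UNIV_compose[OF F_cont]
  let ?G = "\<lambda>\<xi>1. 2 * (G ((\<eta> + h - \<xi>1) / 2) - G ((\<eta> - h - \<xi>1) / 2))"
  let ?F = "\<lambda>\<xi>1. 2 * (F ((\<eta> + h - \<xi>1) / 2) - F ((\<eta> - h - \<xi>1) / 2))"
  have Gi: "?G integrable_on {\<xi> - h..\<xi> + h}" and Fi: "?F integrable_on {\<xi> - h..\<xi> + h}"
    by (intro integrable_continuous_real continuous_intros; simp)+
  have tent_eq: "?I (\<lambda>\<xi>1. 2 * (H ((\<eta> + h - \<xi>1) / 2) - H ((\<eta> - h - \<xi>1) / 2))) = tent H x h" for H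
    using integral_shift_real_ivl[of "\<xi> - h" \<xi> "\<xi> + h" "\<lambda>\<xi>1. 2 * (H ((\<eta> + h - \<xi>1) / 2) - H ((\<eta> - h - \<xi>1) / 2))"]
    by (simp add: tent_def \<xi>_def \<eta>_def algebra_simps add_divide_distrib diff_divide_distrib)
  have "dalembert w x t h = 1 / 4 * ?I (\<lambda>\<xi>1. eta_integral \<xi>1 (\<eta> - h) (\<eta> + h))"
    using rectangle[of "\<xi> - h" "\<xi> + h" "\<eta> - h" "\<eta> + h"] assms(1-4)
    by (simp add: dalembert_def wave_kernel_def \<xi>_def \<eta>_def algebra_simps)
  moreover have "\<bar>?I (\<lambda>\<xi>1. eta_integral \<xi>1 (\<eta> - h) (\<eta> + h)) - w x t * tent G x h\<bar> \<le> \<omega> * tent F x h"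
  proof -
    have diff_eq: "?I (\<lambda>\<xi>1. eta_integral \<xi>1 (\<eta> - h) (\<eta> + h)) - w x t * tent G x h
       = ?I (\<lambda>\<xi>1. eta_integral \<xi>1 (\<eta> - h) (\<eta> + h) - w x t * ?G \<xi>1)"
      unfolding tent_eq[symmetric] integral_mult_right[symmetric]
      by (rule integral_diff[symmetric]) (intro eta_integral_integrable integrable_on_mult_right Gi)+
    have "\<bar>?I (\<lambda>\<xi>1. eta_integral \<xi>1 (\<eta> - h) (\<eta> + h) - w x t * ?G \<xi>1)\<bar> \<le> ?I (\<lambda>\<xi>1. \<omega> * ?F \<xi>1)"
      unfolding real_norm_def[symmetric]
    proof (rule integral_norm_bound_integral)
      fix \<xi>1 assume \<xi>1: "\<xi>1 \<in> {\<xi> - h..\<xi> + h}"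
      show "norm (eta_integral \<xi>1 (\<eta> - h) (\<eta> + h) - w x t * ?G \<xi>1) \<le> \<omega> * ?F \<xi>1"
        unfolding real_norm_def
      proof (rule eta_integral_freeze)
        fix \<eta>1 assume "\<eta> - h \<le> \<eta>1" "\<eta>1 \<le> \<eta> + h"
        hence "\<bar>w ((\<eta>1 - \<xi>1) / 2) ((\<eta>1 + \<xi>1) / 2) - w x t\<bar> \<le> \<omega>"
          by (intro osc) (use \<xi>1 assms(1-4) in \<open>auto simp: \<xi>_def \<eta>_def abs_le_iff field_simps\<close>)
        thus "\<bar>v \<xi>1 \<eta>1 - w x t\<bar> \<le> \<omega>"
          by (simp add: wave_kernel_def field_simps)
      qed (use assms in auto)
    next
      show "(\<lambda>\<xi>1. eta_integral \<xi>1 (\<eta> - h) (\<eta> + h) - w x t * ?G \<xi>1) integrable_on {\<xi> - h..\<xi> + h}"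
        by (intro integrable_diff eta_integral_integrable integrable_on_mult_right Gi)
      show "(\<lambda>\<xi>1. \<omega> * ?F \<xi>1) integrable_on {\<xi> - h..\<xi> + h}"
        by (rule integrable_on_mult_right[OF Fi])
    qed
    also have "\<dots> = \<omega> * ?I ?F" by (rule integral_mult_right)
    also have "?I ?F = tent F x h" by (rule tent_eq)
    finally show ?thesis by (simp only: diff_eq)
  qed
  moreover have "\<bar>d - 1 / 4 * p * m\<bar> \<le> 1 / 4 * \<omega> * k"
    if "d = 1 / 4 * i" "\<bar>i - p * m\<bar> \<le> \<omega> * k" for d i p m k :: real
  proof -
    have "d - 1 / 4 * p * m = 1 / 4 * (i - p * m)" using that(1) by simp
    hence "\<bar>d - 1 / 4 * p * m\<bar> = 1 / 4 * \<bar>i - p * m\<bar>" by (simp only: abs_mult)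
    with that(2) show ?thesis by simp
  qed
  ultimately show ?thesis by blast
qed

text \<open>
  After reflecting the vertex \<open>(x - h, t)\<close>, the alternating sum splits into the sums over two
  rectangles inside the domain; the two extra vertices lie on the diagonal, where \<open>v\<close> vanishes.
\<close>

lemma w_boundary:
  assumes "0 \<le> x" "x \<le> h" "x + h \<le> t" "x + t + h \<le> R"
  shows "\<bar>dalembert w x t h\<bar> \<le> 2 * C * N * h"
proof -
  let ?a = "t - h" and ?b = "t + h"
  have r1: "v (?a + x) (?b - x) - v (?a - x) (?b - x) - v (?a + x) (?a + x) + v (?a - x) (?a + x)
      = - 1 / 4 * integral {?a - x..?a + x} (\<lambda>\<xi>1. eta_integral \<xi>1 (?a + x) (?b - x))"
    by (rule rectangle) (use assms in auto)
  have r2: "v (?b - x) (?b + x) - v (?a - x) (?b + x) - v (?b - x) (?b - x) + v (?a - x) (?b - x)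
      = - 1 / 4 * integral {?a - x..?b - x} (\<lambda>\<xi>1. eta_integral \<xi>1 (?b - x) (?b + x))"
    by (rule rectangle) (use assms in auto)
  have FN: "F a - F b \<le> N" for a b using F_le[of a] F_nonneg[of b] by linarith
  have b1: "\<bar>integral {?a - x..?a + x} (\<lambda>\<xi>1. eta_integral \<xi>1 (?a + x) (?b - x))\<bar> \<le> 2 * C * (2 * h) * N"
    using assms C_nonneg FN F_mono[THEN monoD]
    by (intro order_trans[OF eta_integral_integral_bound] mult_mono mult_nonneg_nonneg) auto
  have b2: "\<bar>integral {?a - x..?b - x} (\<lambda>\<xi>1. eta_integral \<xi>1 (?b - x) (?b + x))\<bar> \<le> 2 * C * (2 * h) * N"
    using assms C_nonneg FN F_mono[THEN monoD]
    by (intro order_trans[OF eta_integral_integral_bound] mult_mono mult_nonneg_nonneg) auto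
  have "dalembert w x t h = v (?a - x) (?b + x) - v (?a + x) (?b - x) - v (?b - x) (?b + x) - v (?a - x) (?a + x)"
    using v_antisym[of "?a + x" "?b - x"] assms
    by (simp add: dalembert_def wave_kernel_def algebra_simps)
  also have "\<dots> = 1 / 4 * integral {?a - x..?a + x} (\<lambda>\<xi>1. eta_integral \<xi>1 (?a + x) (?b - x))
      + 1 / 4 * integral {?a - x..?b - x} (\<lambda>\<xi>1. eta_integral \<xi>1 (?b - x) (?b + x))"
    using r1 r2 v_diag[of "?a + x"] v_diag[of "?b - x"] assms by simp
  finally show ?thesis using b1 b2 by (simp add: algebra_simps abs_le_iff)
qed

text \<open>
  The increment of \<open>v\<close> in \<open>\<eta>\<close> over a length \<open>2 * h\<close> at \<open>\<xi> = h + a \<le> 2 * h\<close>; the double integral in the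
  Goursat equation extends over a rectangle with both sides at most \<open>2 * h\<close>.
\<close>

lemma w_front:
  assumes "\<bar>a\<bar> \<le> h" "2 * h \<le> s" "2 * s - a + h \<le> R"
  shows "\<bar>w (s - a - h) s - w (s - a) (s + h) - 1 / 2 * (G (s + (h - a) / 2) - G (s - (h + a) / 2))\<bar>
          \<le> C * h * (F (s + h) - F (s - 2 * h))"
proof -
  define \<eta> where "\<eta> = 2 * s - a - h"
  have "v (h + a) (\<eta> + 2 * h) - v (h + a) \<eta> = - (1 / 2) * (G ((\<eta> + 2 * h) / 2) - G (\<eta> / 2))
      - 1 / 4 * integral {0..h + a} (\<lambda>\<xi>1. eta_integral \<xi>1 \<eta> (\<eta> + 2 * h))"
    by (rule v_increment) (use assms in \<open>auto simp: \<eta>_def\<close>)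
  moreover have "G ((\<eta> + 2 * h) / 2) = G (s + (h - a) / 2)" "G (\<eta> / 2) = G (s - (h + a) / 2)"
    by (rule arg_cong[where f = G]; simp add: \<eta>_def field_simps)+
  moreover have "w (s - a - h) s = v (h + a) \<eta>" "w (s - a) (s + h) = v (h + a) (\<eta> + 2 * h)"
    by (simp_all add: \<eta>_def wave_kernel_def algebra_simps)
  moreover have "\<bar>p - p' - 1 / 2 * k\<bar> = 1 / 4 * \<bar>i\<bar>" if "p' - p = - (1 / 2) * k - 1 / 4 * i" for p p' k i :: real
    using that by linarith
  ultimately have "\<bar>w (s - a - h) s - w (s - a) (s + h) - 1 / 2 * (G (s + (h - a) / 2) - G (s - (h + a) / 2))\<bar>
     = 1 / 4 * \<bar>integral {0..h + a} (\<lambda>\<xi>1. eta_integral \<xi>1 \<eta> (\<eta> + 2 * h))\<bar>"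
    by simp
  also have "\<dots> \<le> 1 / 4 * (2 * C * (h + a - 0) * (F ((\<eta> + 2 * h - 0) / 2) - F ((\<eta> - (h + a)) / 2)))"
    by (intro mult_left_mono eta_integral_integral_bound) (use assms in \<open>auto simp: \<eta>_def\<close>)
  also have "\<dots> \<le> 1 / 4 * (2 * C * (2 * h) * (F (s + h) - F (s - 2 * h)))"
  proof (intro mult_left_mono mult_mono diff_mono)
    show "F ((\<eta> + 2 * h - 0) / 2) \<le> F (s + h)" "F (s - 2 * h) \<le> F ((\<eta> - (h + a)) / 2)"
      "0 \<le> F ((\<eta> + 2 * h - 0) / 2) - F ((\<eta> - (h + a)) / 2)"
      using assms by (auto intro!: monoD[OF F_mono] simp: \<eta>_def field_simps)
  qed (use assms C_nonneg in auto)
  finally show ?thesis by (simp add: algebra_simps)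
qed

sublocale W: wave_scheme w G F R C N
proof
  show "continuous_on UNIV (\<lambda>(x, t). w x t)"
    unfolding wave_kernel_def split_beta by (intro continuous_on_section[OF v_cont] continuous_intros)
  show "w (- x) t = - w x t" if "\<bar>x\<bar> \<le> t" "t + \<bar>x\<bar> \<le> R" for x t
    using v_antisym[of "t - x" "t + x"] that by (simp add: wave_kernel_def)
  show "\<bar>w x t\<bar> \<le> C" for x t by (simp add: wave_kernel_def v_le)
  show "\<bar>G b - G a\<bar> \<le> F b - F a" if "a \<le> b" for a b using that by (rule G_le_F)
qed (fact G_cont F_cont F_mono F_nonneg F_le w_interior w_boundary w_front)+

end

context bounded_kernel
begin

section \<open>The response function\<close>

definition xi_integral :: "real \<Rightarrow> real \<Rightarrow> real \<Rightarrow> real" where "xi_integral \<tau> a b = integral {a..b} (\<lambda>\<zeta>. integrand \<zeta> \<tau>)"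

text \<open>
  The response function, as twice the derivative of \<open>v\<close> in \<open>\<eta>\<close> on the diagonal.
\<close>

definition boundary_trace :: "real \<Rightarrow> real" where "boundary_trace \<tau> = - (1 / 2) * q (\<tau> / 2) - 1 / 2 * xi_integral \<tau> 0 \<tau>"

lemma N_nonneg: "0 \<le> N"
  using F_nonneg[of 0] F_le[of 0] by linarith

lemma integral_abs_q_reflected: "integral {a..b} (\<lambda>\<zeta>. \<bar>q ((\<tau> - \<zeta>) / 2)\<bar>) \<le> 2 * N"
proof -
  have "integral {a..b} (\<lambda>\<zeta>. \<bar>q ((\<tau> - \<zeta>) / 2)\<bar>) = (\<integral>\<zeta>. indicator {a..b} \<zeta> * \<bar>q ((\<tau> - \<zeta>) / 2)\<bar> \<partial>lborel)"
    by (rule integral_interval_lborel[OF integrable_abs[OF q_affine(2)]])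
  also have "\<dots> \<le> (\<integral>\<zeta>. \<bar>q ((\<tau> - \<zeta>) / 2)\<bar> \<partial>lborel)"
  proof (rule integral_mono)
    show "integrable lborel (\<lambda>\<zeta>. indicator {a..b} \<zeta> * \<bar>q ((\<tau> - \<zeta>) / 2)\<bar>)"
      using integrable_mult_indicator[of "{a..b}" lborel "\<lambda>\<zeta>. \<bar>q ((\<tau> - \<zeta>) / 2)\<bar>"] q_affine(2)[of \<tau>] by simp
  qed (auto intro: integrable_abs q_affine simp: indicator_def)
  also have "\<dots> = 2 * N"
    using lborel_integral_real_affine[of "- 1 / 2" "\<lambda>x. \<bar>q x\<bar>" "\<tau> / 2"]
    by (simp add: N_def field_simps)
  finally show ?thesis .
qed

lemma xi_integral_bound:
  assumes "\<And>\<zeta>. a \<le> \<zeta> \<Longrightarrow> \<zeta> \<le> b \<Longrightarrow> \<bar>v \<zeta> \<tau>\<bar> \<le> \<omega>" "0 \<le> \<omega>"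
  shows "\<bar>xi_integral \<tau> a b\<bar> \<le> 2 * \<omega> * N"
proof -
  have "\<bar>xi_integral \<tau> a b\<bar> \<le> integral {a..b} (\<lambda>\<zeta>. \<omega> * \<bar>q ((\<tau> - \<zeta>) / 2)\<bar>)"
    unfolding xi_integral_def real_norm_def[symmetric]
  proof (rule integral_norm_bound_integral)
    fix \<zeta> assume "\<zeta> \<in> {a..b}"
    thus "norm (integrand \<zeta> \<tau>) \<le> \<omega> * norm (q ((\<tau> - \<zeta>) / 2))"
      using assms(1)[of \<zeta>] by (simp add: integrand_def abs_mult mult.commute[of "q _"] mult_right_mono)
  qed (auto intro!: integrable_on_interval integrand_int' integrable_mult_right integrable_abs q_affine)
  also have "\<dots> = \<omega> * integral {a..b} (\<lambda>\<zeta>. \<bar>q ((\<tau> - \<zeta>) / 2)\<bar>)" by simp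
  also have "\<dots> \<le> \<omega> * (2 * N)"
    by (intro mult_left_mono integral_abs_q_reflected assms)
  finally show ?thesis by simp
qed

lemma xi_integral_set_integrable: "set_integrable lborel {a..b} (\<lambda>\<tau>. xi_integral \<tau> c d)" "set_integrable lborel {a..b} (\<lambda>\<tau>. xi_integral \<tau> c \<tau>)"
proof -
  have "(\<lambda>\<tau>. xi_integral \<tau> c d) \<in> borel_measurable borel"
    unfolding xi_integral_def integral_interval_lborel[OF integrand_int'] by measurable
  thus "set_integrable lborel {a..b} (\<lambda>\<tau>. xi_integral \<tau> c d)"
    by (rule bounded_measurable_set_integrable) (rule xi_integral_bound[OF v_le C_nonneg])
  have "indicator {c..\<tau>} \<zeta> = (if c \<le> \<zeta> \<and> \<zeta> \<le> \<tau> then 1 else 0 :: real)" for \<tau> \<zeta> :: real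
    by (simp add: indicator_def)
  hence "(\<lambda>\<tau>. xi_integral \<tau> c \<tau>) = (\<lambda>\<tau>. \<integral>\<zeta>. (if c \<le> \<zeta> \<and> \<zeta> \<le> \<tau> then 1 else 0) * integrand \<zeta> \<tau> \<partial>lborel)"
    unfolding xi_integral_def integral_interval_lborel[OF integrand_int'] by simp
  moreover have "\<dots> \<in> borel_measurable borel" by measurable
  ultimately show "set_integrable lborel {a..b} (\<lambda>\<tau>. xi_integral \<tau> c \<tau>)"
    by (intro bounded_measurable_set_integrable[OF _ xi_integral_bound[OF v_le C_nonneg]]) simp
qed

lemmas xi_integral_integrable = xi_integral_set_integrable[THEN set_borel_integral_eq_integral(1)]

lemma q_half_set_integrable: "set_integrable lborel {a..b} (\<lambda>\<tau>. q (\<tau> / 2))"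
  using set_integrable_interval[OF q_affine(1)[of 0]] by simp

lemmas q_half_integrable = set_borel_integral_eq_integral(1)[OF q_half_set_integrable]

lemma boundary_trace_set_integrable: "set_integrable lborel {a..b} boundary_trace"
  unfolding boundary_trace_def[abs_def]
  by (intro set_integral_diff set_integrable_mult_right xi_integral_set_integrable q_half_set_integrable impI)

lemmas boundary_trace_integrable = set_borel_integral_eq_integral(1)[OF boundary_trace_set_integrable]

lemma xi_integral_add: "a \<le> b \<Longrightarrow> b \<le> c \<Longrightarrow> xi_integral \<tau> a b + xi_integral \<tau> b c = xi_integral \<tau> a c"
  unfolding xi_integral_def
  by (rule Henstock_Kurzweil_Integration.integral_combine) (auto intro: integrable_on_interval integrand_int')

lemma inner_swap: "integral {a..b} (\<lambda>\<xi>. eta_integral \<xi> c d) = integral {c..d} (\<lambda>\<eta>. xi_integral \<eta> a b)"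
  unfolding eta_integral_def xi_integral_def
proof (rule integral_swap)
  fix \<xi>
  have "(LINT y:{c..d}|lborel. \<bar>integrand \<xi> y\<bar>) \<le> (\<integral>y. \<bar>integrand \<xi> y\<bar> \<partial>lborel)"
    unfolding set_lebesgue_integral_def
  proof (rule integral_mono)
    show "integrable lborel (\<lambda>y. indicator {c..d} y *\<^sub>R \<bar>integrand \<xi> y\<bar>)"
      by (intro integrable_mult_indicator integrable_abs integrand_int) simp
  qed (auto intro: integrable_abs integrand_int simp: indicator_def)
  also have "\<dots> \<le> (\<integral>y. C * \<bar>q ((y - \<xi>) / 2)\<bar> \<partial>lborel)"
    by (intro integral_mono integrable_abs integrand_int integrable_mult_right q_affine)
       (simp add: integrand_def abs_mult mult.commute mult_right_mono v_le)
  also have "\<dots> = C * (2 * N)"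
    using lborel_integral_real_affine[of "1 / 2" "\<lambda>x. \<bar>q x\<bar>" "- \<xi> / 2"]
    by (simp add: N_def field_simps)
  finally show "(LINT y:{c..d}|lborel. \<bar>integrand \<xi> y\<bar>) \<le> C * (2 * N)" .
qed (auto intro: set_integrable_interval integrand_int integrand_int')

end

context goursat_data
begin

text \<open>
  The Goursat equation solved from the line \<open>x = 0\<close> instead of from the front: after exchanging the
  order of integration, the part \<open>\<xi>1 \<le> \<xi>\<close> of the domain is absorbed by the response function, and the
  triangle \<open>\<xi> \<le> \<xi>1 \<le> \<eta>1 \<le> \<eta>\<close> remains.
\<close>

lemma v_minus_response:
  assumes "0 \<le> \<xi>" "\<xi> \<le> \<eta>" "\<eta> \<le> R"
  shows "v \<xi> \<eta> - 1 / 2 * integral {\<xi>..\<eta>} boundary_trace = 1 / 4 * integral {\<xi>..\<eta>} (\<lambda>\<tau>. xi_integral \<tau> \<xi> \<tau>)"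
proof -
  have "integral {\<xi>..\<eta>} boundary_trace = integral {\<xi>..\<eta>} (\<lambda>\<tau>. - (1 / 2) * q (\<tau> / 2) - 1 / 2 * (xi_integral \<tau> 0 \<xi> + xi_integral \<tau> \<xi> \<tau>))"
    using assms by (intro integral_cong) (simp add: boundary_trace_def xi_integral_add)
  also have "\<dots> = - (1 / 2) * integral {\<xi>..\<eta>} (\<lambda>\<tau>. q (\<tau> / 2))
      - 1 / 2 * (integral {\<xi>..\<eta>} (\<lambda>\<tau>. xi_integral \<tau> 0 \<xi>) + integral {\<xi>..\<eta>} (\<lambda>\<tau>. xi_integral \<tau> \<xi> \<tau>))"
    unfolding integral_mult_right[symmetric]
    by (subst integral_diff integral_add integral_mult_right;
       (intro integrable_on_mult_right integrable_add xi_integral_integrable q_half_integrable)?)+ simp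
  also have "integral {\<xi>..\<eta>} (\<lambda>\<tau>. q (\<tau> / 2)) = 2 * integral {\<xi> / 2..\<eta> / 2} q"
    using integral_affine_half[OF q_int, of \<xi> \<eta> 0] by simp
  finally have "integral {\<xi>..\<eta>} boundary_trace = - (1 / 2) * (2 * integral {\<xi> / 2..\<eta> / 2} q)
      - 1 / 2 * (integral {\<xi>..\<eta>} (\<lambda>\<tau>. xi_integral \<tau> 0 \<xi>) + integral {\<xi>..\<eta>} (\<lambda>\<tau>. xi_integral \<tau> \<xi> \<tau>))" .
  moreover have "p - 1 / 2 * i = 1 / 4 * l"
    if "i = - (1 / 2) * (2 * m) - 1 / 2 * (k + l)" "p = - (1 / 2) * m - 1 / 4 * k" for p i k l m :: real
    using that by (simp add: field_simps)
  ultimately show ?thesis using goursat_inner[OF assms] unfolding inner_swap by blast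
qed

text \<open>
  Both the correlation integral and the integral over the triangle below \<open>(s, t)\<close> are at most a
  constant times \<open>s\<close> times the supremum of \<open>\<bar>w\<bar>\<close> on \<open>x \<le> s\<close>, which tends to zero because \<open>w 0 t = 0\<close>.
\<close>

lemma gram_bottom:
  assumes "0 < \<epsilon>"
  shows "\<exists>\<delta>>0. \<forall>s t. 0 \<le> s \<longrightarrow> s \<le> \<delta> \<longrightarrow> s \<le> t \<longrightarrow> s + t \<le> R \<longrightarrow>
      \<bar>gram w s t - (1 / 2 * integral {0..t + s} boundary_trace - 1 / 2 * integral {0..t - s} boundary_trace)\<bar> \<le> \<epsilon> * s"
proof -
  define \<omega> where "\<omega> = \<epsilon> / (C + N + 1)"
  have CN: "0 < C + N + 1" using C_nonneg N_nonneg by linarith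
  have \<omega>: "0 < \<omega>" "(C + N) * \<omega> \<le> \<epsilon>"
    using assms C_nonneg N_nonneg CN by (auto simp: \<omega>_def field_simps)
  have "uniformly_continuous_on ({0..R} \<times> {0..R}) (\<lambda>(x, t). w x t)"
    by (intro compact_uniformly_continuous continuous_on_subset[OF W.w_cont] compact_Times) auto
  from uniformly_continuous_onE[OF this \<omega>(1)] obtain d where d: "0 < d"
    "\<And>x t y \<tau>. x \<in> {0..R} \<Longrightarrow> t \<in> {0..R} \<Longrightarrow> y \<in> {0..R} \<Longrightarrow> \<tau> \<in> {0..R} \<Longrightarrow>
       dist (y, \<tau>) (x, t) < d \<Longrightarrow> dist (w y \<tau>) (w x t) < \<omega>"
    by (metis (no_types, lifting) SigmaI case_prod_conv)
  have small: "\<bar>w x t\<bar> \<le> \<omega>" if "0 \<le> x" "x \<le> d / 2" "x \<le> t" "x + t \<le> R" for x t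
  proof -
    have "dist (w x t) (w 0 t) < \<omega>"
      by (intro d(2)) (use that d(1) in \<open>auto simp: dist_prod_def\<close>)
    thus ?thesis using W.w_zero[of t] that by (simp add: dist_real_def)
  qed
  show ?thesis
  proof (intro exI[of _ "d / 2"] conjI allI impI)
    fix s t assume st: "0 \<le> s" "s \<le> d / 2" "s \<le> t" "s + t \<le> R"
    have "\<bar>correlation w s t\<bar> \<le> (C * \<omega>) * (s - 0)"
      unfolding correlation_def
    proof (rule integral_bound_const)
      fix x assume "x \<in> {0..s}"
      thus "\<bar>w x t * w x s\<bar> \<le> C * \<omega>"
        unfolding abs_mult by (intro mult_mono W.w_le small) (use st C_nonneg in auto)
    qed (use st in \<open>auto intro!: continuous_intros continuous_on_section[OF W.w_cont]\<close>)
    moreover have "\<bar>1 / 4 * integral {t - s..t + s} (\<lambda>\<tau>. xi_integral \<tau> (t - s) \<tau>)\<bar> \<le> 1 / 4 * (2 * s * (2 * \<omega> * N))"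
    proof -
      have "\<bar>integral {t - s..t + s} (\<lambda>\<tau>. xi_integral \<tau> (t - s) \<tau>)\<bar> \<le> integral {t - s..t + s} (\<lambda>_. 2 * \<omega> * N)"
        unfolding real_norm_def[symmetric]
      proof (rule integral_norm_bound_integral)
        fix \<tau> assume \<tau>: "\<tau> \<in> {t - s..t + s}"
        show "norm (xi_integral \<tau> (t - s) \<tau>) \<le> 2 * \<omega> * N"
          unfolding real_norm_def
        proof (rule xi_integral_bound)
          fix \<zeta> assume \<zeta>: "t - s \<le> \<zeta>" "\<zeta> \<le> \<tau>"
          have "\<bar>w ((\<tau> - \<zeta>) / 2) ((\<tau> + \<zeta>) / 2)\<bar> \<le> \<omega>"
            by (intro small) (use \<zeta> \<tau> st in \<open>auto simp: field_simps\<close>)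
          thus "\<bar>v \<zeta> \<tau>\<bar> \<le> \<omega>" by (simp add: wave_kernel_def field_simps)
        qed (use \<omega> in simp)
      qed (auto intro: xi_integral_integrable)
      thus ?thesis using st by (simp add: mult_ac)
    qed
    moreover have "w s t - 1 / 2 * integral {t - s..t + s} boundary_trace = 1 / 4 * integral {t - s..t + s} (\<lambda>\<tau>. xi_integral \<tau> (t - s) \<tau>)"
      using v_minus_response[of "t - s" "t + s"] st by (simp add: wave_kernel_def)
    moreover have "integral {0..t - s} boundary_trace + integral {t - s..t + s} boundary_trace = integral {0..t + s} boundary_trace"
      by (rule Henstock_Kurzweil_Integration.integral_combine) (use st boundary_trace_integrable in auto)
    ultimately have "\<bar>gram w s t - (1 / 2 * integral {0..t + s} boundary_trace - 1 / 2 * integral {0..t - s} boundary_trace)\<bar>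
       \<le> C * \<omega> * s + s * \<omega> * N"
      unfolding gram_def by (simp add: abs_le_iff algebra_simps)
    also have "\<dots> = (C + N) * \<omega> * s" by (simp add: algebra_simps)
    also have "\<dots> \<le> \<epsilon> * s" by (rule mult_right_mono[OF \<omega>(2) st(1)])
    finally show "\<bar>gram w s t - (1 / 2 * integral {0..t + s} boundary_trace - 1 / 2 * integral {0..t - s} boundary_trace)\<bar> \<le> \<epsilon> * s" .
  qed (use d in auto)
qed

lemma gram_eq_response:
  assumes "0 \<le> s" "s \<le> t" "s + t \<le> R"
  shows "gram w s t = 1 / 2 * integral {0..t + s} boundary_trace - 1 / 2 * integral {0..t - s} boundary_trace"
  using W.gram_eq_dalembert_solution[of "\<lambda>x. 1 / 2 * integral {0..x} boundary_trace", OF gram_bottom assms] by simp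

end

section \<open>From locally integrable potentials to the Gram kernel\<close>

lemma compact_continuous_extension:
  fixes f :: "real \<Rightarrow> real \<Rightarrow> real"
  assumes "compact S" "continuous_on S (\<lambda>(x, y). f x y)"
  obtains f' C where "continuous_on UNIV (\<lambda>(x, y). f' x y)" "\<And>x y. \<bar>f' x y\<bar> \<le> C"
    "\<And>x y. (x, y) \<in> S \<Longrightarrow> f' x y = (f x y :: real)"
proof -
  have "bounded ((\<lambda>(x, y). f x y) ` S)"
    by (intro compact_imp_bounded compact_continuous_image assms)
  then obtain C where C: "\<And>z. z \<in> S \<Longrightarrow> norm ((\<lambda>(x, y). f x y) z) \<le> C"
    unfolding bounded_iff by blast
  obtain g where g: "continuous_on UNIV g" "\<And>z. z \<in> S \<Longrightarrow> g z = (\<lambda>(x, y). f x y) z"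
    "\<And>z. norm (g z) \<le> max 0 C"
  proof (rule Tietze[OF assms(2), of UNIV "max 0 C"])
    show "closedin (top_of_set UNIV) S" using compact_imp_closed[OF assms(1)] by simp
    show "norm (case z of (x, y) \<Rightarrow> f x y) \<le> max 0 C" if "z \<in> S" for z
      using C[OF that] by linarith
  qed auto
  show thesis
    by (rule that[of "\<lambda>x y. g (x, y)" "max 0 C"]) (use g in auto)
qed

lemma antisymmetric_extension:
  fixes v :: "real \<Rightarrow> real \<Rightarrow> real"
  assumes v: "continuous_on {(\<xi>, \<eta>). 0 \<le> \<xi> \<and> \<xi> \<le> \<eta>} (\<lambda>(\<xi>, \<eta>). v \<xi> \<eta>)"
    and diag: "\<And>\<xi>. 0 \<le> \<xi> \<Longrightarrow> v \<xi> \<xi> = 0"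
  obtains v' C where "continuous_on UNIV (\<lambda>(\<xi>, \<eta>). v' \<xi> \<eta>)" "\<And>\<xi> \<eta>. \<bar>v' \<xi> \<eta>\<bar> \<le> C"
    "\<And>\<xi> \<eta>. 0 \<le> \<xi> \<Longrightarrow> \<xi> \<le> \<eta> \<Longrightarrow> \<eta> \<le> R \<Longrightarrow> v' \<xi> \<eta> = v \<xi> \<eta>"
    "\<And>\<xi> \<eta>. 0 \<le> \<xi> \<Longrightarrow> \<xi> \<le> R \<Longrightarrow> 0 \<le> \<eta> \<Longrightarrow> \<eta> \<le> R \<Longrightarrow> v' \<eta> \<xi> = - v' \<xi> \<eta>"
proof -
  let ?u = "\<lambda>\<xi> \<eta>. if \<xi> \<le> \<eta> then v \<xi> \<eta> else - v \<eta> \<xi>"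
  let ?U = "{0..R} \<times> {0..R} \<inter> {(\<xi>, \<eta>). \<xi> \<le> \<eta>}" and ?L = "{0..R} \<times> {0..R} \<inter> {(\<xi>, \<eta>). \<eta> \<le> \<xi>}"
  have cl: "closed {(\<xi>, \<eta>). \<xi> \<le> (\<eta>::real)}" "closed {(\<xi>, \<eta>). \<eta> \<le> (\<xi>::real)}"
    unfolding split_beta by (intro closed_Collect_le continuous_intros)+
  have "continuous_on (?U \<union> ?L) (\<lambda>z. if fst z \<le> snd z then v (fst z) (snd z) else - v (snd z) (fst z))"
  proof (rule continuous_on_cases)
    show "closed ?U" "closed ?L" by (intro closed_Int closed_Times cl; simp)+
    show "continuous_on ?U (\<lambda>z. v (fst z) (snd z))"
      using continuous_on_subset[OF v, of ?U] by (simp add: split_beta subset_iff)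
    have "continuous_on ?L ((\<lambda>(\<xi>, \<eta>). v \<xi> \<eta>) \<circ> (\<lambda>z. (snd z, fst z)))"
      by (intro continuous_on_compose continuous_intros continuous_on_subset[OF v]) auto
    thus "continuous_on ?L (\<lambda>z. - v (snd z) (fst z))"
      by (intro continuous_intros) (simp add: o_def)
    show "\<forall>z. z \<in> ?U \<and> \<not> fst z \<le> snd z \<or> z \<in> ?L \<and> fst z \<le> snd z \<longrightarrow> v (fst z) (snd z) = - v (snd z) (fst z)"
      using diag by (auto dest: order_antisym)
  qed
  moreover have "?U \<union> ?L = {0..R} \<times> {0..R}" by auto
  ultimately have "continuous_on ({0..R} \<times> {0..R}) (\<lambda>(\<xi>, \<eta>). ?u \<xi> \<eta>)"
    by (simp add: split_beta)
  from compact_continuous_extension[OF _ this] obtain v' C where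
    v': "continuous_on UNIV (\<lambda>(\<xi>, \<eta>). v' \<xi> \<eta>)" "\<And>\<xi> \<eta>. \<bar>v' \<xi> \<eta>\<bar> \<le> C"
      "\<And>\<xi> \<eta>. (\<xi>, \<eta>) \<in> {0..R} \<times> {0..R} \<Longrightarrow> v' \<xi> \<eta> = ?u \<xi> \<eta>"
    by (metis compact_Icc compact_Times)
  show thesis
  proof (rule that[OF v'(1,2)])
    fix \<xi> \<eta> :: real
    show "v' \<xi> \<eta> = v \<xi> \<eta>" if "0 \<le> \<xi>" "\<xi> \<le> \<eta>" "\<eta> \<le> R"
      using v'(3)[of \<xi> \<eta>] that by simp
    show "v' \<eta> \<xi> = - v' \<xi> \<eta>" if "0 \<le> \<xi>" "\<xi> \<le> R" "0 \<le> \<eta>" "\<eta> \<le> R"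
      using v'(3)[of \<xi> \<eta>] v'(3)[of \<eta> \<xi>] diag[of \<xi>] that by auto
  qed
qed

text \<open>
  Passing to a Borel function which agrees almost everywhere makes product measurability available.
\<close>

lemma borel_representative:
  assumes "L1_loc q" "0 < B"
  obtains q' Z where "q' \<in> borel_measurable borel" "integrable lborel q'" "negligible Z"
    "\<And>x. 0 \<le> x \<Longrightarrow> x \<le> B \<Longrightarrow> x \<notin> Z \<Longrightarrow> q x = (q' x :: real)"
proof -
  have i: "integrable lebesgue (\<lambda>x. indicator {0..B} x *\<^sub>R q x)"
    using assms by (auto simp: L1_loc_def set_integrable_def)
  from completion_ex_borel_measurable_real[OF borel_measurable_integrable[OF i]]
  obtain q' where q': "q' \<in> borel_measurable lborel" "AE x in lborel. indicator {0..B} x *\<^sub>R q x = q' x"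
    by auto
  have ae: "AE x in lebesgue. indicator {0..B} x *\<^sub>R q x = q' x"
    by (rule AE_completion[OF q'(2)])
  have "integrable lebesgue q'"
    using i by (rule integrable_cong_AE_imp) (use q' ae in \<open>auto simp: measurable_completion eq_commute\<close>)
  hence "integrable lborel q'" using q'(1) by (simp add: integrable_completion)
  moreover obtain Z where "{x \<in> space lebesgue. indicator {0..B} x *\<^sub>R q x \<noteq> q' x} \<subseteq> Z"
      "emeasure lebesgue Z = 0" "Z \<in> sets lebesgue"
    using AE_E[OF ae] by blast
  ultimately show thesis
    by (intro that[of q' Z]) (use q' in \<open>force simp: negligible_iff_null_sets null_sets_def\<close>)+
qed

lemma lebesgue_set_integral_spike:
  fixes f g :: "real \<Rightarrow> real"
  assumes g: "set_integrable lborel {a..b} g" and Z: "negligible Z"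
    and eq: "\<And>x. a \<le> x \<Longrightarrow> x \<le> b \<Longrightarrow> x \<notin> Z \<Longrightarrow> f x = g x"
  shows "(LINT x:{a..b}|lebesgue. f x) = integral {a..b} g"
proof -
  have "g absolutely_integrable_on {a..b}"
    using g unfolding set_integrable_def by (simp add: integrable_completion)
  hence "f absolutely_integrable_on {a..b}"
    by (rule absolutely_integrable_spike[OF _ Z]) (use eq in auto)
  from set_lebesgue_integral_eq_integral(2)[OF this]
  have "(LINT x:{a..b}|lebesgue. f x) = integral {a..b} f" .
  also have "\<dots> = integral {a..b} g"
    by (rule integral_spike[OF Z]) (use eq in auto)
  finally show ?thesis .
qed

text \<open>
  Exceptional points of \<open>q\<close> stay negligible in the integrals in which \<open>q\<close> has the argument
  \<open>(\<eta> - \<xi>) / 2\<close>, for each fixed value of the other variable.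
\<close>

lemma negligible_affine_preimage:
  fixes Z :: "real set"
  assumes "negligible Z" "m \<noteq> 0"
  shows "negligible {x. m * x + c \<in> Z}"
proof -
  have "negligible ((\<lambda>z. (z - c) / m) ` Z)"
    by (rule negligible_differentiable_image_negligible[OF _ assms(1)])
       (use assms(2) in \<open>auto intro!: derivative_intros simp: differentiable_on_def\<close>)
  moreover have "{x. m * x + c \<in> Z} \<subseteq> (\<lambda>z. (z - c) / m) ` Z"
    using assms(2) by (force simp: field_simps)
  ultimately show ?thesis by (rule negligible_subset)
qed

lemma lebesgue_integral_singleton: "(LINT x:{a}|lebesgue. f x) = (0 :: real)" for a :: real
proof -
  have "AE x in lebesgue. x \<noteq> a" by (rule AE_completion[OF AE_lborel_singleton])
  hence "AE x in lebesgue. indicator {a} x *\<^sub>R f x = 0" by eventually_elim simp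
  thus ?thesis unfolding set_lebesgue_integral_def by (rule integral_eq_zero_AE)
qed

lemma goursat_solution_diag:
  assumes "goursat_solution q v" "0 \<le> \<xi>"
  shows "v \<xi> \<xi> = 0"
proof -
  have "v \<xi> \<xi> = - (1 / 2) * (LINT \<alpha>:{\<xi> / 2..\<xi> / 2}|lebesgue. q \<alpha>)
    - (1 / 4) * (LINT \<xi>1:{0..\<xi>}|lebesgue. LINT \<eta>1:{\<xi>..\<xi>}|lebesgue. q ((\<eta>1 - \<xi>1) / 2) * v \<xi>1 \<eta>1)"
    using assms unfolding goursat_solution_def by blast
  also have "\<dots> = 0"
    by (simp add: lebesgue_integral_singleton)
  finally show ?thesis .
qed

text \<open>
  The connecting kernel is the Gram kernel of the wave kernel. The function \<open>w'\<close> is a continuous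
  extension of the wave kernel to the plane.
\<close>

lemma connecting_kernel_identity:
  assumes q: "L1_loc q" and R: "0 < R" and v: "goursat_solution q v"
  shows "\<exists>w'. continuous_on UNIV (\<lambda>(x, t). w' x t) \<and>
     (\<forall>x t. 0 \<le> x \<longrightarrow> x \<le> t \<longrightarrow> x + t \<le> R \<longrightarrow> w' x t = wave_kernel v x t) \<and>
     (\<forall>s t. 0 \<le> s \<longrightarrow> s \<le> t \<longrightarrow> s + t \<le> R \<longrightarrow>
        gram w' s t =
        half_primitive (response q v) (t + s) - half_primitive (response q v) (t - s))"
proof -
  obtain q' Z where q': "q' \<in> borel_measurable borel" "integrable lborel q'" and Z: "negligible Z"
    and qq': "\<And>x. 0 \<le> x \<Longrightarrow> x \<le> R / 2 \<Longrightarrow> x \<notin> Z \<Longrightarrow> q x = q' x"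
    using borel_representative[OF q, of "R / 2"] R by (metis half_gt_zero)
  have v_cont: "continuous_on {(\<xi>, \<eta>). 0 \<le> \<xi> \<and> \<xi> \<le> \<eta>} (\<lambda>(\<xi>, \<eta>). v \<xi> \<eta>)"
    using v by (simp add: goursat_solution_def)
  obtain v' C where v'_cont: "continuous_on UNIV (\<lambda>(\<xi>, \<eta>). v' \<xi> \<eta>)" and v'_le: "\<And>\<xi> \<eta>. \<bar>v' \<xi> \<eta>\<bar> \<le> C"
    and v'_eq: "\<And>\<xi> \<eta>. 0 \<le> \<xi> \<Longrightarrow> \<xi> \<le> \<eta> \<Longrightarrow> \<eta> \<le> R \<Longrightarrow> v' \<xi> \<eta> = v \<xi> \<eta>"
    and v'_anti: "\<And>\<xi> \<eta>. 0 \<le> \<xi> \<Longrightarrow> \<xi> \<le> R \<Longrightarrow> 0 \<le> \<eta> \<Longrightarrow> \<eta> \<le> R \<Longrightarrow> v' \<eta> \<xi> = - v' \<xi> \<eta>"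
    using antisymmetric_extension[OF v_cont goursat_solution_diag[OF v], of R] by blast
  interpret bk: bounded_kernel q' v' C
    by unfold_locales (fact q' v'_cont v'_le)+
  have neg: "negligible {\<eta>. (\<eta> - \<xi>) / 2 \<in> Z}" "negligible {\<xi>. (\<eta> - \<xi>) / 2 \<in> Z}" for \<xi> \<eta>
    using negligible_affine_preimage[OF Z, of "1 / 2" "- \<xi> / 2"]
      negligible_affine_preimage[OF Z, of "- 1 / 2" "\<eta> / 2"] by (simp_all add: diff_divide_distrib)
  have J: "(LINT \<eta>1:{\<xi>..\<eta>}|lebesgue. q ((\<eta>1 - \<xi>1) / 2) * v \<xi>1 \<eta>1) = bk.eta_integral \<xi>1 \<xi> \<eta>"
    if "0 \<le> \<xi>1" "\<xi>1 \<le> \<xi>" "\<eta> \<le> R" for \<xi>1 \<xi> \<eta>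
    unfolding bk.eta_integral_def
  proof (rule lebesgue_set_integral_spike[OF set_integrable_interval[OF bk.integrand_int] neg(1)])
    fix x assume "\<xi> \<le> x" "x \<le> \<eta>" "x \<notin> {\<eta>. (\<eta> - \<xi>1) / 2 \<in> Z}"
    thus "q ((x - \<xi>1) / 2) * v \<xi>1 x = bk.integrand \<xi>1 x"
      using qq'[of "(x - \<xi>1) / 2"] v'_eq[of \<xi>1 x] that by (simp add: bk.integrand_def)
  qed
  have K: "(LINT \<zeta>:{0..\<tau>}|lebesgue. q ((\<tau> - \<zeta>) / 2) * v \<zeta> \<tau>) = bk.xi_integral \<tau> 0 \<tau>" if "\<tau> \<le> R" for \<tau>
    unfolding bk.xi_integral_def
  proof (rule lebesgue_set_integral_spike[OF set_integrable_interval[OF bk.integrand_int'] neg(2)])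
    fix x assume "0 \<le> x" "x \<le> \<tau>" "x \<notin> {\<zeta>. (\<tau> - \<zeta>) / 2 \<in> Z}"
    thus "q ((\<tau> - x) / 2) * v x \<tau> = bk.integrand x \<tau>"
      using qq'[of "(\<tau> - x) / 2"] v'_eq[of x \<tau>] that by (simp add: bk.integrand_def)
  qed
  interpret gd: goursat_data q' v' C R
  proof
    fix \<xi> \<eta> :: real assume *: "0 \<le> \<xi>" "\<xi> \<le> \<eta>" "\<eta> \<le> R"
    have "v \<xi> \<eta> = - (1 / 2) * (LINT \<alpha>:{\<xi> / 2..\<eta> / 2}|lebesgue. q \<alpha>)
          - (1 / 4) * (LINT \<xi>1:{0..\<xi>}|lebesgue. LINT \<eta>1:{\<xi>..\<eta>}|lebesgue. q ((\<eta>1 - \<xi>1) / 2) * v \<xi>1 \<eta>1)"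
      using v * unfolding goursat_solution_def by blast
    also have "(LINT \<alpha>:{\<xi> / 2..\<eta> / 2}|lebesgue. q \<alpha>) = integral {\<xi> / 2..\<eta> / 2} q'"
      by (rule lebesgue_set_integral_spike[OF set_integrable_interval[OF q'(2)] Z]) (use * in \<open>auto intro: qq'\<close>)
    also have "(LINT \<xi>1:{0..\<xi>}|lebesgue. LINT \<eta>1:{\<xi>..\<eta>}|lebesgue. q ((\<eta>1 - \<xi>1) / 2) * v \<xi>1 \<eta>1)
        = integral {0..\<xi>} (\<lambda>\<xi>1. bk.eta_integral \<xi>1 \<xi> \<eta>)"
      by (rule lebesgue_set_integral_spike[OF bk.eta_integral_set_integrable negligible_empty]) (use * in \<open>auto intro: J\<close>)
    finally show "v' \<xi> \<eta> = - (1 / 2) * integral {\<xi> / 2..\<eta> / 2} q'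
        - (1 / 4) * integral {0..\<xi>} (\<lambda>\<xi>1. integral {\<xi>..\<eta>} (\<lambda>\<eta>1. q' ((\<eta>1 - \<xi>1) / 2) * v' \<xi>1 \<eta>1))"
      using v'_eq[of \<xi> \<eta>] * by (simp add: bk.eta_integral_def bk.integrand_def[abs_def])
  qed (fact v'_anti)
  have hp: "half_primitive (response q v) x = 1 / 2 * integral {0..x} bk.boundary_trace" if "0 \<le> x" "x \<le> R" for x
  proof -
    have "negligible {\<tau>. \<tau> / 2 \<in> Z}" using neg(1)[of 0] by simp
    hence "(LINT s:{0..x}|lebesgue. response q v s) = integral {0..x} bk.boundary_trace"
    proof (rule lebesgue_set_integral_spike[OF bk.boundary_trace_set_integrable])
      fix s assume "0 \<le> s" "s \<le> x" "s \<notin> {\<tau>. \<tau> / 2 \<in> Z}"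
      thus "response q v s = bk.boundary_trace s"
        using K[of s] qq'[of "s / 2"] that by (simp add: response_def bk.boundary_trace_def)
    qed
    thus ?thesis using that by (simp add: half_primitive_def)
  qed
  show ?thesis
  proof (intro exI[of _ "wave_kernel v'"] conjI allI impI)
    show "continuous_on UNIV (\<lambda>(x, t). wave_kernel v' x t)" by (fact gd.W.w_cont)
    show "wave_kernel v' x t = wave_kernel v x t" if "0 \<le> x" "x \<le> t" "x + t \<le> R" for x t
      using that v'_eq[of "t - x" "t + x"] by (simp add: wave_kernel_def)
    show "gram (wave_kernel v') s t =
        half_primitive (response q v) (t + s) - half_primitive (response q v) (t - s)"
      if "0 \<le> s" "s \<le> t" "s + t \<le> R" for s t
      using gd.gram_eq_response[OF that] hp[of "t + s"] hp[of "t - s"] that by simp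
  qed
qed

section \<open>The resolvent kernel\<close>

lemma AE_zero_continuous:
  fixes f :: "real \<Rightarrow> real"
  assumes "AE x in lebesgue. x \<in> S \<longrightarrow> f x = 0" "open S" "continuous_on S f" "x \<in> S"
  shows "f x = 0"
proof (rule ccontr)
  assume "f x \<noteq> 0"
  let ?U = "S \<inter> f -` (- {0})"
  have "open ?U" by (rule continuous_open_preimage[OF assms(3,2)]) auto
  moreover obtain Z where "{x \<in> space lebesgue. \<not> (x \<in> S \<longrightarrow> f x = 0)} \<subseteq> Z" "emeasure lebesgue Z = 0" "Z \<in> sets lebesgue"
    using AE_E[OF assms(1)] by blast
  hence "negligible Z" "?U \<subseteq> Z" by (auto simp: negligible_iff_null_sets null_sets_def)
  hence "negligible ?U" using negligible_subset by blast
  moreover have "x \<in> ?U" using assms(4) \<open>f x \<noteq> 0\<close> by auto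
  ultimately show False using open_not_negligible by blast
qed

lemma zero_if_integrals_zero:
  fixes f :: "real \<Rightarrow> real"
  assumes f: "continuous_on {a..b} f" and z: "a < z" "z < b"
    and zero: "\<And>c. a < c \<Longrightarrow> c < b \<Longrightarrow> integral {a..c} f = 0"
  shows "f z = 0"
proof -
  have "((\<lambda>u. integral {a..u} f) has_real_derivative f z) (at z within {a..b})"
    by (rule integral_has_real_derivative[OF f]) (use z in auto)
  hence "((\<lambda>u. integral {a..u} f) has_real_derivative f z) (at z)"
    using z by (simp add: at_within_Icc_at)
  moreover have "((\<lambda>u. integral {a..u} f) has_real_derivative 0) (at z)"
    by (rule has_field_derivative_transform_within_open[OF DERIV_const[where k = "0::real"], where S = "{a<..<b}"])
       (use z zero in auto)
  ultimately show ?thesis by (rule DERIV_unique)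
qed

lemma integral_swap_continuous_real:
  fixes f :: "real \<Rightarrow> real \<Rightarrow> real"
  assumes "continuous_on UNIV (\<lambda>(x, y). f x y)"
  shows "integral {a..b} (\<lambda>x. integral {c..d} (f x)) = integral {c..d} (\<lambda>y. integral {a..b} (\<lambda>x. f x y))"
  using integral_swap_continuous[of a c b d f] continuous_on_subset[OF assms] by simp

text \<open>
  Exchanging the order of integration over the triangle \<open>a \<le> x \<le> y \<le> b\<close>.
\<close>

lemma integral_swap_triangle:
  fixes f :: "real \<Rightarrow> real \<Rightarrow> real"
  assumes f: "continuous_on UNIV (\<lambda>(x, y). f x y)"
  shows "integral {a..b} (\<lambda>x. integral {x..b} (f x)) = integral {a..b} (\<lambda>y. integral {a..y} (\<lambda>x. f x y))"
proof -
  define h where "h x y = (if x \<le> y then f x y else 0)" for x y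
  have f_meas [measurable]: "(\<lambda>(x, y). f x y) \<in> borel_measurable (borel \<Otimes>\<^sub>M borel)"
    unfolding borel_prod by (rule borel_measurable_continuous_onI[OF f])
  have h_meas [measurable]: "(\<lambda>(x, y). h x y) \<in> borel_measurable (borel \<Otimes>\<^sub>M borel)"
    unfolding h_def by measurable
  have "bounded ((\<lambda>(x, y). f x y) ` ({a..b} \<times> {a..b}))"
    by (intro compact_imp_bounded compact_continuous_image compact_Times continuous_on_subset[OF f]) auto
  then obtain B where "\<And>p. p \<in> (\<lambda>(x, y). f x y) ` ({a..b} \<times> {a..b}) \<Longrightarrow> norm p \<le> B"
    unfolding bounded_iff by blast
  hence B: "\<bar>f x y\<bar> \<le> B" if "x \<in> {a..b}" "y \<in> {a..b}" for x y
    using that by force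
  have hB: "\<bar>h x y\<bar> \<le> \<bar>B\<bar>" if "x \<in> {a..b}" "y \<in> {a..b}" for x y
    using B[OF that] by (auto simp: h_def)
  have hx: "set_integrable lborel {a..b} (h x)" if "x \<in> {a..b}" for x
    by (rule bounded_measurable_set_integrable[OF _ hB[OF that]]) simp
  have swap: "integral {a..b} (\<lambda>x. integral {a..b} (h x)) = integral {a..b} (\<lambda>y. integral {a..b} (\<lambda>x. h x y))"
  proof (rule integral_swap[OF h_meas hx])
    show "set_integrable lborel {a..b} (\<lambda>x. h x y)" if "y \<in> {a..b}" for y
      by (rule bounded_measurable_set_integrable[OF _ hB[OF _ that]]) simp
    show "(LINT y:{a..b}|lborel. \<bar>h x y\<bar>) \<le> (LINT y:{a..b}|lborel. \<bar>B\<bar>)" if "x \<in> {a..b}" for x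
    proof (rule set_integral_mono)
      show "set_integrable lborel {a..b} (\<lambda>y. \<bar>h x y\<bar>)" by (rule set_integrable_abs[OF hx[OF that]])
      show "set_integrable lborel {a..b} (\<lambda>y. \<bar>B\<bar>)"
        by (rule bounded_measurable_set_integrable[where B = "\<bar>B\<bar>"]) auto
    qed (use hB that in auto)
  qed
  have *: "integral {a..b} (h x) = integral {x..b} (f x)" if "x \<in> {a..b}" for x
  proof -
    have "integral {a..b} (h x) = integral {a..b} (\<lambda>y. if y \<in> {x..b} then f x y else 0)"
      by (rule integral_cong) (auto simp: h_def)
    also have "\<dots> = integral {x..b} (f x)"
      unfolding Henstock_Kurzweil_Integration.integral_restrict_Int
      using that by (simp add: Int_absorb2)
    finally show ?thesis .
  qed
  have **: "integral {a..b} (\<lambda>x. h x y) = integral {a..y} (\<lambda>x. f x y)" if "y \<in> {a..b}" for y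
  proof -
    have "integral {a..b} (\<lambda>x. h x y) = integral {a..b} (\<lambda>x. if x \<in> {a..y} then f x y else 0)"
      by (rule integral_cong) (auto simp: h_def)
    also have "\<dots> = integral {a..y} (\<lambda>x. f x y)"
      unfolding Henstock_Kurzweil_Integration.integral_restrict_Int
      using that by (simp add: Int_absorb2)
    finally show ?thesis .
  qed
  have "integral {a..b} (\<lambda>x. integral {a..b} (h x)) = integral {a..b} (\<lambda>x. integral {x..b} (f x))"
    "integral {a..b} (\<lambda>y. integral {a..b} (\<lambda>x. h x y)) = integral {a..b} (\<lambda>y. integral {a..y} (\<lambda>x. f x y))"
    by (rule integral_cong; use * ** in simp)+
  with swap show ?thesis by simp
qed

text \<open>
  Here \<open>w\<close> and \<open>H\<close> are meant as continuous extensions of the kernels of \<open>W - I\<close> and \<open>W\<^sup>-\<^sup>1 - I\<close>, which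
  live on \<open>x \<le> y\<close>.
\<close>

locale resolvent_pair =
  fixes w H :: "real \<Rightarrow> real \<Rightarrow> real"
  assumes w_cont: "continuous_on UNIV (\<lambda>(x, y). w x y)"
    and H_cont: "continuous_on UNIV (\<lambda>(x, y). H x y)"
begin

lemmas [continuous_intros] = continuous_on_section[OF w_cont] continuous_on_section[OF H_cont]
  gram_continuous[OF w_cont]

text \<open>
  The kernel of \<open>W (I + H) - I\<close>.
\<close>

definition defect :: "real \<Rightarrow> real \<Rightarrow> real" where
  "defect x z = H x z + w x z + integral {x..z} (\<lambda>\<tau>. w x \<tau> * H \<tau> z)"

lemma defect_continuous: "continuous_on {x..b} (defect x)"
  unfolding defect_def
  by (intro continuous_intros continuous_on_variable_integral[where f = "\<lambda>z \<tau>. w x \<tau> * H \<tau> z"])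
     (auto simp: split_beta intro!: continuous_intros)

lemma tail_continuous: "continuous_on S (\<lambda>\<tau>. integral {\<tau>..c} (H \<tau>))"
proof -
  have "continuous_on S (\<lambda>\<tau>. integral {min \<tau> c..c} (H \<tau>))"
    by (intro continuous_on_variable_integral continuous_intros) (auto simp: split_beta intro!: continuous_intros)
  thus ?thesis by (rule continuous_on_eq) (auto simp: min_def)
qed

lemma integral_defect:
  assumes "x \<le> c"
  shows "integral {x..c} (defect x) =
    integral {x..c} (H x) + integral {x..c} (\<lambda>\<tau>. w x \<tau> * (1 + integral {\<tau>..c} (H \<tau>)))"
proof -
  have "integral {x..c} (\<lambda>\<tau>. w x \<tau> * integral {\<tau>..c} (H \<tau>)) =
      integral {x..c} (\<lambda>\<tau>. integral {\<tau>..c} (\<lambda>z. w x \<tau> * H \<tau> z))" by simp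
  also have "\<dots> = integral {x..c} (\<lambda>z. integral {x..z} (\<lambda>\<tau>. w x \<tau> * H \<tau> z))"
    by (rule integral_swap_triangle) (auto simp: split_beta intro!: continuous_intros)
  finally have sw: "integral {x..c} (\<lambda>z. integral {x..z} (\<lambda>\<tau>. w x \<tau> * H \<tau> z)) =
      integral {x..c} (\<lambda>\<tau>. w x \<tau> * integral {\<tau>..c} (H \<tau>))" by simp
  have "integral {x..c} (\<lambda>\<tau>. w x \<tau> * (1 + integral {\<tau>..c} (H \<tau>)))
      = integral {x..c} (w x) + integral {x..c} (\<lambda>\<tau>. w x \<tau> * integral {\<tau>..c} (H \<tau>))"
    unfolding distrib_left mult_1_right
    by (rule integral_add) (auto intro!: integrable_continuous_real continuous_intros tail_continuous)
  moreover have "integral {x..c} (defect x) = integral {x..c} (H x) + integral {x..c} (w x)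
      + integral {x..c} (\<lambda>z. integral {x..z} (\<lambda>\<tau>. w x \<tau> * H \<tau> z))"
  proof -
    have "continuous_on {x..c} (\<lambda>z. integral {x..z} (\<lambda>\<tau>. w x \<tau> * H \<tau> z))"
      by (intro continuous_intros continuous_on_variable_integral[where f = "\<lambda>z \<tau>. w x \<tau> * H \<tau> z"])
         (auto simp: split_beta intro!: continuous_intros)
    moreover have "continuous_on {x..c} (\<lambda>z. w x z)" "continuous_on {x..c} (\<lambda>z. H x z)"
      by (intro continuous_intros)+
    ultimately show ?thesis unfolding defect_def
      by (simp add: integral_add integrable_continuous_real continuous_on_add)
  qed
  ultimately show ?thesis using sw by simp
qed

text \<open>
  The hypothesis says that \<open>W (I + H)\<close> maps the indicator function of \<open>[0, c]\<close> to a function equal to \<open>1\<close>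
  on \<open>(0, c)\<close>. Testing with
  these functions for all \<open>c\<close> determines the kernel by differentiation in \<open>c\<close>.
\<close>

lemma defect_zero:
  assumes AE: "\<And>c. 0 < c \<Longrightarrow> c < T \<Longrightarrow> AE x in lebesgue. 0 < x \<longrightarrow> x < c \<longrightarrow>
      integral {x..c} (H x) + integral {x..c} (\<lambda>\<tau>. w x \<tau> * (1 + integral {\<tau>..c} (H \<tau>))) = 0"
    and xz: "0 < x" "x < z" "z < T"
  shows "defect x z = 0"
proof (rule zero_if_integrals_zero[OF defect_continuous[of x T]])
  fix c assume c: "x < c" "c < T"
  let ?f = "\<lambda>x. integral {x..c} (H x) + integral {x..c} (\<lambda>\<tau>. w x \<tau> * (1 + integral {\<tau>..c} (H \<tau>)))"
  have "?f x = 0"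
  proof (rule AE_zero_continuous[where S = "{0<..<c}" and f = ?f])
    show "AE x in lebesgue. x \<in> {0<..<c} \<longrightarrow> ?f x = 0"
      using AE[of c] c xz by (auto elim: eventually_mono)
    have c: "continuous_on UNIV (\<lambda>(x, \<tau>). w x \<tau> * (1 + integral {\<tau>..c} (H \<tau>)))"
      unfolding split_beta by (intro continuous_intros continuous_on_compose2[OF tail_continuous[of UNIV c]]) auto
    show "continuous_on {0<..<c} ?f"
      by (intro continuous_on_add continuous_on_variable_integral continuous_on_id continuous_on_const
            continuous_on_subset[OF H_cont] continuous_on_subset[OF c]) auto
  qed (use c xz in auto)
  thus "integral {x..c} (defect x) = 0" using integral_defect[of x c] c by simp
qed (use xz in auto)

text \<open>
  The entry of \<open>(I + gram) (I + H) = W\<^sup>* W (I + H)\<close> at \<open>(t, y)\<close>, above the diagonal. In the double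
  integrals the integration over \<open>x\<close> is done first, so that for each \<open>z\<close> the entry of \<open>W (I + H)\<close> at
  \<open>(z, y)\<close> appears, which is zero.
\<close>

lemma gram_resolvent:
  assumes t: "0 < t" "t < y" "y < T"
    and w0: "w 0 t = 0"
    and defect: "\<And>x z. 0 < x \<Longrightarrow> x < z \<Longrightarrow> z < T \<Longrightarrow> defect x z = 0"
  shows "gram w t y + H t y + integral {0..y} (\<lambda>x. gram w (min x t) (max x t) * H x y) = 0"
proof -
  let ?I = "\<lambda>z a b. integral {a..b} (\<lambda>x. w z x * H x y)"
  have I_cont: "continuous_on S (\<lambda>z. ?I z (a z) (b z))"
    if "continuous_on S a" "continuous_on S b" "\<And>z. z \<in> S \<Longrightarrow> a z \<le> b z" for S a b
    by (rule continuous_on_variable_integral[OF _ that]) (auto simp: split_beta intro!: continuous_intros)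
  have "integral {0..y} (\<lambda>x. gram w (min x t) (max x t) * H x y)
      = integral {0..t} (\<lambda>x. gram w (min x t) (max x t) * H x y) + integral {t..y} (\<lambda>x. gram w (min x t) (max x t) * H x y)"
    by (rule Henstock_Kurzweil_Integration.integral_combine[symmetric])
       (use t in \<open>auto intro!: integrable_continuous_real continuous_intros\<close>)
  also have "integral {0..t} (\<lambda>x. gram w (min x t) (max x t) * H x y) = integral {0..t} (\<lambda>x. gram w x t * H x y)"
    by (rule integral_cong) (auto simp: min_def max_def)
  also have "\<dots> = integral {0..t} (\<lambda>x. w x t * H x y)
      + integral {0..t} (\<lambda>x. integral {0..x} (\<lambda>z. w z t * w z x * H x y))"
  proof -
    have c: "continuous_on {0..t} (\<lambda>x. integral {0..x} (\<lambda>z. w z t * w z x) * H x y)"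
      by (intro continuous_intros continuous_on_variable_integral) (auto simp: split_beta intro!: continuous_intros)
    have "integral {0..t} (\<lambda>x. gram w x t * H x y) = integral {0..t} (\<lambda>x. w x t * H x y)
        + integral {0..t} (\<lambda>x. integral {0..x} (\<lambda>z. w z t * w z x) * H x y)"
      unfolding gram_def correlation_def distrib_right
      by (rule integral_add) (auto intro!: integrable_continuous_real c continuous_intros)
    thus ?thesis by simp
  qed
  also have "integral {0..t} (\<lambda>x. integral {0..x} (\<lambda>z. w z t * w z x * H x y))
      = integral {0..t} (\<lambda>z. integral {z..t} (\<lambda>x. w z t * w z x * H x y))"
    by (rule integral_swap_triangle[symmetric]) (auto simp: split_beta intro!: continuous_intros)
  also have "\<dots> = integral {0..t} (\<lambda>z. w z t * ?I z z t)" by (simp add: mult.assoc)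
  also have "integral {t..y} (\<lambda>x. gram w (min x t) (max x t) * H x y) = integral {t..y} (\<lambda>x. gram w t x * H x y)"
    by (rule integral_cong) (auto simp: min_def max_def)
  also have "\<dots> = ?I t t y + integral {t..y} (\<lambda>x. integral {0..t} (\<lambda>z. w z t * w z x * H x y))"
  proof -
    have c: "continuous_on {t..y} (\<lambda>x. integral {0..t} (\<lambda>z. w z x * w z t) * H x y)"
      by (intro continuous_intros continuous_on_variable_integral) (use t in \<open>auto simp: split_beta intro!: continuous_intros\<close>)
    have "integral {t..y} (\<lambda>x. gram w t x * H x y) = ?I t t y
        + integral {t..y} (\<lambda>x. integral {0..t} (\<lambda>z. w z x * w z t) * H x y)"
      unfolding gram_def correlation_def distrib_right
      by (rule integral_add) (auto intro!: integrable_continuous_real c continuous_intros)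
    thus ?thesis by (simp add: mult.commute)
  qed
  also have "integral {t..y} (\<lambda>x. integral {0..t} (\<lambda>z. w z t * w z x * H x y))
      = integral {0..t} (\<lambda>z. integral {t..y} (\<lambda>x. w z t * w z x * H x y))"
    by (rule integral_swap_continuous_real) (auto simp: split_beta intro!: continuous_intros)
  also have "\<dots> = integral {0..t} (\<lambda>z. w z t * ?I z t y)" by (simp add: mult.assoc)
  finally have 1: "integral {0..y} (\<lambda>x. gram w (min x t) (max x t) * H x y) =
      integral {0..t} (\<lambda>x. w x t * H x y) + integral {0..t} (\<lambda>z. w z t * ?I z z t)
      + (?I t t y + integral {0..t} (\<lambda>z. w z t * ?I z t y))" .
  have "integral {0..t} (\<lambda>x. w x t * H x y) + integral {0..t} (\<lambda>z. w z t * ?I z z t)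
      + integral {0..t} (\<lambda>z. w z t * ?I z t y)
     = integral {0..t} (\<lambda>z. w z t * H z y + w z t * ?I z z t + w z t * ?I z t y)"
  proof -
    have i: "(\<lambda>z. w z t * H z y) integrable_on {0..t}" "(\<lambda>z. w z t * ?I z z t) integrable_on {0..t}"
      "(\<lambda>z. w z t * ?I z t y) integrable_on {0..t}"
      by (intro integrable_continuous_real continuous_on_mult I_cont continuous_intros; use t in simp)+
    show ?thesis
      using integral_add[OF integrable_add[OF i(1,2)] i(3)] integral_add[OF i(1,2)] by simp
  qed
  also have "\<dots> = integral {0..t} (\<lambda>z. - (w z y * w z t))"
  proof (rule integral_cong)
    fix z assume z: "z \<in> {0..t}"
    show "w z t * H z y + w z t * ?I z z t + w z t * ?I z t y = - (w z y * w z t)"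
    proof (cases "z = 0")
      case False
      have "?I z z t + ?I z t y = ?I z z y"
        by (rule Henstock_Kurzweil_Integration.integral_combine) (use z t in \<open>auto intro!: integrable_continuous_real continuous_intros\<close>)
      moreover have "H z y + w z y + ?I z z y = 0"
        using defect[of z y] z t False by (simp add: defect_def)
      ultimately have "w z t * (H z y + ?I z z t + ?I z t y) = w z t * (- w z y)"
        by (intro arg_cong[where f = "\<lambda>p. w z t * p"]) linarith
      thus ?thesis by (simp add: algebra_simps)
    qed (simp add: w0)
  qed
  finally have 2: "integral {0..t} (\<lambda>x. w x t * H x y) + integral {0..t} (\<lambda>z. w z t * ?I z z t)
      + integral {0..t} (\<lambda>z. w z t * ?I z t y) = - integral {0..t} (\<lambda>z. w z y * w z t)"
    by simp
  have 3: "H t y + w t y + ?I t t y = 0"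
    using defect[OF t] by (simp add: defect_def)
  show ?thesis using 1 2 3 unfolding gram_def correlation_def by linarith
qed

end

section \<open>The integral equation\<close>

lemma integral_reverse:
  fixes f :: "real \<Rightarrow> real"
  shows "integral {T - b..T - a} (\<lambda>y. f (T - y)) = integral {a..b} f"
  using integral_shift_real_ivl[of "T - b" T "T - a" "\<lambda>y. f (T - y)"]
    Henstock_Kurzweil_Integration.integral_reflect_real[of b a f] by simp

lemma lebesgue_integral_continuous:
  fixes f :: "real \<Rightarrow> real"
  assumes "continuous_on {a..b} f"
  shows "(LINT x:{a..b}|lebesgue. f x) = integral {a..b} f"
  by (rule set_lebesgue_integral_eq_integral(2)[OF absolutely_integrable_continuous_real[OF assms]])

lemma half_primitive_even: "half_primitive r (a - b) = half_primitive r (b - a)"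
  by (simp add: half_primitive_def abs_minus_commute)

lemma square_integrable_indicator: "square_integrable T (indicator {a..b})"
  unfolding square_integrable_def
proof
  show "indicator {a..b} \<in> borel_measurable (lebesgue_on {0<..<T})"
    by (intro measurable_restrict_space1 borel_measurable_indicator) simp
  have "{0<..<T} \<inter> {a..b} \<in> lmeasurable"
    by (intro bounded_set_imp_lmeasurable bounded_Int) auto
  hence "integrable lebesgue (indicator ({0<..<T} \<inter> {a..b}) :: real \<Rightarrow> real)"
    by (auto simp: fmeasurable_def)
  moreover have "indicator ({0<..<T} \<inter> {a..b}) = (\<lambda>x. indicator {0<..<T} x *\<^sub>R (indicator {a..b} x :: real)\<^sup>2)"
    by (auto simp: indicator_def)
  ultimately show "integrable (lebesgue_on {0<..<T}) (\<lambda>x. (indicator {a..b} x :: real)\<^sup>2)"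
    by (simp add: integrable_restrict_space)
qed

theorem theorem3:
  fixes q :: "real \<Rightarrow> real" and T :: real
    and v V :: "real \<Rightarrow> real \<Rightarrow> real"
  assumes "L1_loc q"
    and "T > 0"
    and "goursat_solution q v"
    and "inverse_control_kernel v T V"
  shows "\<forall>y t. 0 < y \<longrightarrow> y < t \<longrightarrow> t < T \<longrightarrow>
    V y t + connecting_kernel q v T y t
      + (LINT s:{y..T}|lebesgue. connecting_kernel q v T t s * V y s) = 0"
proof -
  let ?p = "half_primitive (response q v)"
  obtain w where w_cont: "continuous_on UNIV (\<lambda>(x, t). w x t)"
    and w_eq: "\<And>x t. 0 \<le> x \<Longrightarrow> x \<le> t \<Longrightarrow> x + t \<le> 2 * T \<Longrightarrow> w x t = wave_kernel v x t"
    and w_gram: "\<And>s t. 0 \<le> s \<Longrightarrow> s \<le> t \<Longrightarrow> s + t \<le> 2 * T \<Longrightarrow>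
       gram w s t = ?p (t + s) - ?p (t - s)"
    using connecting_kernel_identity[OF assms(1) _ assms(3), of "2 * T"] assms(2) by auto
  \<comment> \<open>The reflection \<open>t \<mapsto> T - t\<close> turns \<open>V\<close> into the kernel \<open>H\<close> of the inverse of \<open>W\<close>.\<close>
  let ?S = "{(x, y). 0 \<le> x \<and> x \<le> y \<and> y \<le> T}"
  have "compact ?S"
  proof -
    have "compact ({0..T} \<times> {0..T} \<inter> {z. fst z \<le> snd z})"
      by (intro compact_Int_closed compact_Times compact_Icc closed_Collect_le
            continuous_on_fst continuous_on_snd continuous_on_id)
    moreover have "{0..T} \<times> {0..T} \<inter> {z. fst z \<le> snd z} = ?S" by auto
    ultimately show ?thesis by simp
  qed
  moreover have "continuous_on ?S (\<lambda>(x, y). V (T - y) (T - x))"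
  proof -
    have "continuous_on {(y, t). 0 \<le> y \<and> y \<le> t \<and> t \<le> T} (\<lambda>(y, t). V y t)"
      using assms(4) by (simp add: inverse_control_kernel_def)
    moreover have "continuous_on ?S (\<lambda>z. (T - snd z, T - fst z))"
      by (intro continuous_intros)
    ultimately have "continuous_on ?S (\<lambda>z. (\<lambda>(y, t). V y t) (T - snd z, T - fst z))"
      by (rule continuous_on_compose2) auto
    thus ?thesis by (simp add: split_beta)
  qed
  ultimately obtain H C where H_cont: "continuous_on UNIV (\<lambda>(x, y). H x y)"
    and "\<And>x y. \<bar>H x y\<bar> \<le> C"
    and H_eq0: "\<And>x y. (x, y) \<in> ?S \<Longrightarrow> H x y = V (T - y) (T - x)"
    by (rule compact_continuous_extension) blast
  from H_eq0 have H_eq: "\<And>x y. 0 \<le> x \<Longrightarrow> x \<le> y \<Longrightarrow> y \<le> T \<Longrightarrow> H x y = V (T - y) (T - x)" by simp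
  interpret resolvent_pair w H
    by unfold_locales (fact w_cont H_cont)+

  have inverse: "AE x in lebesgue. 0 < x \<longrightarrow> x < c \<longrightarrow>
      integral {x..c} (H x) + integral {x..c} (\<lambda>\<tau>. w x \<tau> * (1 + integral {\<tau>..c} (H \<tau>))) = 0"
    if c: "0 < c" "c < T" for c
  proof -
    let ?a = "indicator {0..c} :: real \<Rightarrow> real"
    have inv: "id_plus_volterra_reflect V T ?a (T - \<tau>) = ?a \<tau> + integral {\<tau>..c} (H \<tau>)"
      if \<tau>: "0 \<le> \<tau>" "\<tau> \<le> T" for \<tau>
    proof -
      have "volterra_op V (reflect_op T ?a) (T - \<tau>) = (LINT y:{T - c..T - \<tau>}|lebesgue. H \<tau> (T - y))"
        unfolding volterra_op_def set_lebesgue_integral_def reflect_op_def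
        by (rule Bochner_Integration.integral_cong) (use c \<tau> in \<open>auto simp: indicator_def H_eq\<close>)
      also have "\<dots> = integral {T - c..T - \<tau>} (\<lambda>y. H \<tau> (T - y))"
        by (intro lebesgue_integral_continuous continuous_intros)
      also have "\<dots> = integral {\<tau>..c} (H \<tau>)" by (rule integral_reverse)
      finally show ?thesis by (simp add: id_plus_volterra_reflect_def reflect_op_def)
    qed
    have "control_op v T (id_plus_volterra_reflect V T ?a) x =
        1 + integral {x..c} (H x) + integral {x..c} (\<lambda>\<tau>. w x \<tau> * (1 + integral {\<tau>..c} (H \<tau>)))"
      if x: "0 < x" "x < c" for x
    proof -
      have "(LINT \<tau>:{x..T}|lebesgue. wave_kernel v x \<tau> * id_plus_volterra_reflect V T ?a (T - \<tau>))
          = (LINT \<tau>:{x..c}|lebesgue. w x \<tau> * (1 + integral {\<tau>..c} (H \<tau>)))"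
        unfolding set_lebesgue_integral_def
        by (rule Bochner_Integration.integral_cong) (use c x in \<open>auto simp: indicator_def inv w_eq\<close>)
      also have "\<dots> = integral {x..c} (\<lambda>\<tau>. w x \<tau> * (1 + integral {\<tau>..c} (H \<tau>)))"
        by (intro lebesgue_integral_continuous continuous_intros tail_continuous)
      finally show ?thesis using inv[of x] c x by (simp add: control_op_def)
    qed
    moreover have "AE x in lebesgue. 0 < x \<and> x < T \<longrightarrow> control_op v T (id_plus_volterra_reflect V T ?a) x = ?a x"
      using assms(4) square_integrable_indicator[of T 0 c]
      by (auto simp: inverse_control_kernel_def AE_restrict_space_iff)
    ultimately show ?thesis
      by (elim eventually_mono) (use c in \<open>auto simp: indicator_def\<close>)
  qed

  show ?thesis
  proof (intro allI impI)
    fix y t assume yt: "0 < y" "y < t" "t < T"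
    \<comment> \<open>The reflection reverses the order of \<open>y\<close> and \<open>t\<close>.\<close>
    define \<xi> \<zeta> where "\<xi> = T - t" and "\<zeta> = T - y"
    have \<xi>\<zeta>: "0 < \<xi>" "\<xi> < \<zeta>" "\<zeta> < T" using yt by (auto simp: \<xi>_def \<zeta>_def)
    let ?k = "\<lambda>x. gram w (min x \<xi>) (max x \<xi>) * H x \<zeta>"
    have "w 0 \<xi> = 0"
      using w_eq[of 0 \<xi>] goursat_solution_diag[OF assms(3), of \<xi>] \<xi>\<zeta> by (simp add: wave_kernel_def)
    hence "gram w \<xi> \<zeta> + H \<xi> \<zeta> + integral {0..\<zeta>} ?k = 0"
      using \<xi>\<zeta> by (intro gram_resolvent[where T = T] defect_zero[OF inverse]) auto
    moreover have "H \<xi> \<zeta> = V y t" using H_eq[of \<xi> \<zeta>] yt by (simp add: \<xi>_def \<zeta>_def)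
    moreover have "gram w \<xi> \<zeta> = connecting_kernel q v T y t"
      using w_gram[of \<xi> \<zeta>] yt half_primitive_even[of _ y t]
      by (simp add: connecting_kernel_def \<xi>_def \<zeta>_def algebra_simps)
    moreover have "(LINT s:{y..T}|lebesgue. connecting_kernel q v T t s * V y s) = integral {0..\<zeta>} ?k"
    proof -
      have "connecting_kernel q v T t s * V y s = ?k (T - s)" if s: "s \<in> {y..T}" for s
      proof -
        have "gram w (min (T - s) \<xi>) (max (T - s) \<xi>) = ?p (2 * T - t - s) - ?p (t - s)"
        proof (cases "t \<le> s")
          case True
          thus ?thesis using w_gram[of "T - s" \<xi>] s yt half_primitive_even[of _ t s]
            by (simp add: \<xi>_def min_def max_def algebra_simps)
        next
          case False
          thus ?thesis using w_gram[of \<xi> "T - s"] s yt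
            by (simp add: \<xi>_def min_def max_def algebra_simps)
        qed
        moreover have "H (T - s) \<zeta> = V y s" using H_eq[of "T - s" \<zeta>] s yt by (simp add: \<zeta>_def)
        ultimately show ?thesis by (simp add: connecting_kernel_def)
      qed
      hence "(LINT s:{y..T}|lebesgue. connecting_kernel q v T t s * V y s) = (LINT s:{y..T}|lebesgue. ?k (T - s))"
        by (intro set_lebesgue_integral_cong) auto
      also have "\<dots> = integral {y..T} (\<lambda>s. ?k (T - s))"
        by (intro lebesgue_integral_continuous continuous_intros) (use \<xi>\<zeta> in auto)
      also have "\<dots> = integral {0..\<zeta>} ?k"
        using integral_reverse[of T \<zeta> 0 ?k] by (simp add: \<zeta>_def)
      finally show ?thesis .
    qed
    ultimately show "V y t + connecting_kernel q v T y t
      + (LINT s:{y..T}|lebesgue. connecting_kernel q v T t s * V y s) = 0" by simp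
  qed
qed

end
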